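(* Let $L$ and $L^*$ be two Finsler structures on a manifold $M$, with Cartan connections $\nabla,\nabla^*$, and let $B(\overline X,\overline Y)=\nabla^*_{\beta\overline X}\overline Y-\nabla_{\beta\overline X}\overline Y$ for $\overline X,\overline Y\in\mathfrak X(\pi(M))$. Suppose that the $\pi$-tensor field $B$ vanishes. Then $(M,L)$ is a Landsberg manifold if and only if $(M,L^* )$ is a Landsberg manifold.
   Context: $M$ is a finite-dimensional $C^\infty$ manifold and all objects are $C^\infty$. $\pi:\mathcal TM\to M$ is the bundle of nonzero tangent vectors; $\pi^{-1}(TM)\to\mathcal TM$ is the pullback of $TM$ by $\pi$. Sections of $\pi^{-1}(TM)$ are called $\pi$-vector fields, form the module $\mathfrak X(\pi(M))$, and are written $\overline X$; tensor fields on $\pi^{-1}(TM)$ are called $\pi$-tensor fields. $\overline\eta(u)=(u,u)$ is the fundamental $\pi$-vector field. There is an exact sequence $0\to\pi^{-1}(TM)\xrightarrow{\gamma}T(\mathcal TM)\xrightarrow{\rho}\pi^{-1}(TM)\to0$, where $\gamma(u,v)$ is the vertical lift of $v$ to $u$ and $\rho(X)=(u,d\pi(X))$ for $X\in T_u(\mathcal TM)$. For a connection $\nabla$ on $\pi^{-1}(TM)$, its connection map is $K(X)=\nabla_X\overline\eta$, $X\in T(\mathcal TM)$. The horizontal space is $H_u=\{X\in T_u(\mathcal TM):K(X)=0\}$, the vertical space is $V_u=\ker\rho_u$; $\nabla$ is regular if $T_u(\mathcal TM)=V_u\oplus H_u$ for all $u$, and then $\beta=(\rho|_{H})^{-1}:\pi^{-1}(TM)\to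 H$. The torsion form is $\mathbf T(X,Y)=\nabla_X\rho Y-\nabla_Y\rho X-\rho[X,Y]$, with $S(\overline X,\overline Y)=\mathbf T(\beta\overline X,\beta\overline Y)$ and $T(\overline X,\overline Y)=\mathbf T(\gamma\overline X,\beta\overline Y)$. The curvature is $\mathbf R(X,Y)=[\nabla_Y,\nabla_X]+\nabla_{[X,Y]}$, and the mixed curvature is $P(\overline X,\overline Y)\overline Z=\mathbf R(\gamma\overline X,\beta\overline Y)\overline Z$. A Finsler structure $L:TM\to[0,\infty)$ is smooth on $\mathcal TM$, positively homogeneous of degree 1 on fibres, with $g$ := fibrewise Hessian of $\frac12L^2$ positive definite (a metric on $\pi^{-1}(TM)$). Its Cartan connection is the unique regular connection $\nabla$ on $\pi^{-1}(TM)$ with $\nabla g=0$, $S=0$ and $g(T(\overline X,\overline Y),\overline Z)=g(T(\overline X,\overline Z),\overline Y)$; it satisfies $K\circ\gamma=\mathrm{id}$, so $X=\gamma KX+\beta\rho X$. Objects of $(M,L^* )$ carry an asterisk ($\nabla^*,\beta^*,P^*,\dots$). $(M,L)$ is a Landsberg manifold if $P(\overline X,\overline Y)\overline\eta=0$ for all $\overline X,\overline Y\in\mathfrak X(\pi(M))$; $(M,L^* )$ is Landsberg if $P^*(\overline X,\overline Y)\overline\eta=0$ for all $\overline X,\overline Y$. *)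

theory Defs
  imports "HOL-Analysis.Analysis" "HOL-Library.Function_Algebras"
begin

section \<open>Smooth manifolds\<close>

instantiation "fun" :: (type, scaleR) scaleR
begin
definition scaleR_fun_def: "scaleR a f = (\<lambda>x. a *\<^sub>R f x)"
instance ..
end

instance "fun" :: (type, real_vector) real_vector
  by standard (simp_all add: scaleR_fun_def plus_fun_def scaleR_add_left scaleR_add_right)

primrec ck_on :: "nat \<Rightarrow> 'e::real_normed_vector set \<Rightarrow> ('e \<Rightarrow> 'f::real_normed_vector) \<Rightarrow> bool" where
  "ck_on 0 S f \<longleftrightarrow> continuous_on S f"
| "ck_on (Suc k) S f \<longleftrightarrow>
     (\<forall>x\<in>S. f differentiable (at x)) \<and> (\<forall>v. ck_on k S (\<lambda>x. frechet_derivative f (at x) v))"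

text \<open>Only used for open \<open>S\<close>.\<close>

definition smooth_on :: "'e::real_normed_vector set \<Rightarrow> ('e \<Rightarrow> 'f::real_normed_vector) \<Rightarrow> bool" where
  "smooth_on S f \<longleftrightarrow> (\<forall>k. ck_on k S f)"

text \<open>A chart is its domain together with its coordinate map; the values of the map outside
  the domain are irrelevant.\<close>

type_synonym ('a, 'e) chart = "'a set \<times> ('a \<Rightarrow> 'e)"

definition chart_inv :: "('a, 'e) chart \<Rightarrow> 'e \<Rightarrow> 'a" where
  "chart_inv c = inv_into (fst c) (snd c)"

definition carrier_of :: "('a, 'e) chart set \<Rightarrow> 'a set" where
  "carrier_of A = (\<Union>c\<in>A. fst c)"

definition atlas_topology :: "('a, 'e::topological_space) chart set \<Rightarrow> 'a topology" where
  "atlas_topology A =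
     topology (\<lambda>U. U \<subseteq> carrier_of A \<and> (\<forall>c\<in>A. open (snd c ` (U \<inter> fst c))))"

text \<open>A smooth manifold is given by a (not necessarily maximal) smooth atlas on the set of its
  points, which determines the topology.\<close>

definition smooth_manifold :: "('a, 'e::euclidean_space) chart set \<Rightarrow> bool" where
  "smooth_manifold A \<longleftrightarrow>
     (\<forall>c\<in>A. inj_on (snd c) (fst c) \<and> open (snd c ` fst c)) \<and>
     (\<forall>c\<in>A. \<forall>d\<in>A. open (snd c ` (fst c \<inter> fst d)) \<and>
        smooth_on (snd c ` (fst c \<inter> fst d)) (snd d \<circ> chart_inv c)) \<and>
     Hausdorff_space (atlas_topology A) \<and> second_countable (atlas_topology A)"

lemma openin_atlas_topology:
  assumes "\<And>c. c \<in> A \<Longrightarrow> inj_on (snd c) (fst c)"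
  shows "openin (atlas_topology A) U \<longleftrightarrow>
           U \<subseteq> carrier_of A \<and> (\<forall>c\<in>A. open (snd c ` (U \<inter> fst c)))"
proof -
  have "istopology (\<lambda>U. U \<subseteq> carrier_of A \<and> (\<forall>c\<in>A. open (snd c ` (U \<inter> fst c))))"
    unfolding istopology_def
  proof (intro conjI allI impI ballI; (elim conjE)?)
    fix S T c assume "c \<in> A" and S: "\<forall>c\<in>A. open (snd c ` (S \<inter> fst c))"
      and T: "\<forall>c\<in>A. open (snd c ` (T \<inter> fst c))"
    have "snd c ` (S \<inter> T \<inter> fst c) = snd c ` (S \<inter> fst c) \<inter> snd c ` (T \<inter> fst c)"
      using assms[OF \<open>c \<in> A\<close>] by (auto simp: inj_on_def)
    then show "open (snd c ` (S \<inter> T \<inter> fst c))"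
      using S T \<open>c \<in> A\<close> by auto
  next
    fix \<K> c assume "c \<in> A"
      and K: "\<forall>K\<in>\<K>. K \<subseteq> carrier_of A \<and> (\<forall>c\<in>A. open (snd c ` (K \<inter> fst c)))"
    have "snd c ` (\<Union>\<K> \<inter> fst c) = (\<Union>K\<in>\<K>. snd c ` (K \<inter> fst c))"
      by auto
    then show "open (snd c ` (\<Union>\<K> \<inter> fst c))"
      using K \<open>c \<in> A\<close> by auto
  qed auto
  then show ?thesis
    by (simp add: atlas_topology_def)
qed

text \<open>Smoothness of \<open>f\<close> on an open set \<open>U\<close> of a manifold.\<close>

definition smooth_fun :: "('a, 'e::euclidean_space) chart set \<Rightarrow> 'a set \<Rightarrow> ('a \<Rightarrow> 'f::real_normed_vector) \<Rightarrow> bool" where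
  "smooth_fun A U f \<longleftrightarrow> (\<forall>c\<in>A. smooth_on (snd c ` (U \<inter> fst c)) (f \<circ> chart_inv c))"


section \<open>Tangent vectors and vector fields\<close>

text \<open>A tangent vector at \<open>p\<close> is the family of its components in the charts around \<open>p\<close>, related
  by the derivatives of the coordinate changes. Components in other charts are set to \<open>0\<close>, so
  that each tangent space is a subspace of a function space.\<close>

type_synonym ('a, 'e) tvec = "('a, 'e) chart \<Rightarrow> 'e"

definition tangent_space :: "('a, 'e::euclidean_space) chart set \<Rightarrow> 'a \<Rightarrow> ('a, 'e) tvec set" where
  "tangent_space A p = {v.
     (\<forall>c\<in>A. \<forall>d\<in>A. p \<in> fst c \<and> p \<in> fst d \<longrightarrow>
        v d = frechet_derivative (snd d \<circ> chart_inv c) (at (snd c p)) (v c)) \<and>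
     (\<forall>c. \<not> (c \<in> A \<and> p \<in> fst c) \<longrightarrow> v c = 0)}"

definition chart_at :: "('a, 'e) chart set \<Rightarrow> 'a \<Rightarrow> ('a, 'e) chart" where
  "chart_at A p = (SOME c. c \<in> A \<and> p \<in> fst c)"

text \<open>\<open>differential A B f p\<close> is the differential at \<open>p\<close> of a map \<open>f\<close> between the manifolds
  \<open>A\<close> and \<open>B\<close>, and \<open>dir_deriv A p v f\<close> is the derivative \<open>v f\<close> of a function \<open>f\<close> along a
  tangent vector \<open>v\<close> at \<open>p\<close>; by the chain rule the chosen chart around \<open>p\<close> is immaterial.
  \<open>velocity A \<sigma> t\<close> is the tangent vector at \<open>\<sigma> t\<close> of a curve \<open>\<sigma>\<close>.\<close>

definition differential ::
  "('a, 'e::euclidean_space) chart set \<Rightarrow> ('b, 'f::euclidean_space) chart set \<Rightarrow> ('a \<Rightarrow> 'b)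
    \<Rightarrow> 'a \<Rightarrow> ('a, 'e) tvec \<Rightarrow> ('b, 'f) tvec" where
  "differential A B f p v = (let c = chart_at A p in
     (\<lambda>d. if d \<in> B \<and> f p \<in> fst d
          then frechet_derivative (snd d \<circ> f \<circ> chart_inv c) (at (snd c p)) (v c) else 0))"

definition dir_deriv ::
  "('a, 'e::euclidean_space) chart set \<Rightarrow> 'a \<Rightarrow> ('a, 'e) tvec \<Rightarrow> ('a \<Rightarrow> real) \<Rightarrow> real" where
  "dir_deriv A p v f = (let c = chart_at A p in
     frechet_derivative (f \<circ> chart_inv c) (at (snd c p)) (v c))"

definition velocity :: "('a, 'e::euclidean_space) chart set \<Rightarrow> (real \<Rightarrow> 'a) \<Rightarrow> real \<Rightarrow> ('a, 'e) tvec" where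
  "velocity A \<sigma> t =
     (\<lambda>c. if c \<in> A \<and> \<sigma> t \<in> fst c then vector_derivative (snd c \<circ> \<sigma>) (at t) else 0)"

text \<open>Smooth vector fields on an open set \<open>U\<close>; their values outside \<open>U\<close> are arbitrary.\<close>

definition vector_fields :: "('a, 'e::euclidean_space) chart set \<Rightarrow> 'a set \<Rightarrow> ('a \<Rightarrow> ('a, 'e) tvec) set" where
  "vector_fields A U = {X.
     (\<forall>p\<in>U. X p \<in> tangent_space A p) \<and>
     (\<forall>c\<in>A. smooth_fun A (U \<inter> fst c) (\<lambda>p. X p c))}"

definition lie_bracket ::
  "('a, 'e::euclidean_space) chart set \<Rightarrow> ('a \<Rightarrow> ('a, 'e) tvec) \<Rightarrow> ('a \<Rightarrow> ('a, 'e) tvec)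
    \<Rightarrow> 'a \<Rightarrow> ('a, 'e) tvec" where
  "lie_bracket A X Y p = (\<lambda>c. if c \<in> A \<and> p \<in> fst c then
       frechet_derivative (\<lambda>x. Y (chart_inv c x) c) (at (snd c p)) (X p c)
     - frechet_derivative (\<lambda>x. X (chart_inv c x) c) (at (snd c p)) (Y p c) else 0)"


section \<open>The slit tangent bundle and the pullback bundle\<close>

type_synonym ('a, 'e) tpoint = "'a \<times> ('a, 'e) tvec"
type_synonym ('a, 'e) ttvec = "(('a, 'e) tpoint, 'e \<times> 'e) tvec"
type_synonym ('a, 'e) pi_field = "('a, 'e) tpoint \<Rightarrow> ('a, 'e) tvec"

definition tangent_bundle :: "('a, 'e::euclidean_space) chart set \<Rightarrow> ('a, 'e) tpoint set" where
  "tangent_bundle M = {(p, v). p \<in> carrier_of M \<and> v \<in> tangent_space M p}"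

definition slit_bundle :: "('a, 'e::euclidean_space) chart set \<Rightarrow> ('a, 'e) tpoint set" where
  "slit_bundle M = {(p, v). p \<in> carrier_of M \<and> v \<in> tangent_space M p \<and> v \<noteq> 0}"

text \<open>The induced charts \<open>(x, y)\<close> make \<open>slit_bundle M\<close> a manifold.\<close>

definition slit_chart ::
  "('a, 'e::euclidean_space) chart set \<Rightarrow> ('a, 'e) chart \<Rightarrow> (('a, 'e) tpoint, 'e \<times> 'e) chart" where
  "slit_chart M c = ({u \<in> slit_bundle M. fst u \<in> fst c}, (\<lambda>u. (snd c (fst u), snd u c)))"

definition slit_atlas ::
  "('a, 'e::euclidean_space) chart set \<Rightarrow> (('a, 'e) tpoint, 'e \<times> 'e) chart set" where
  "slit_atlas M = slit_chart M ` M"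

text \<open>The fibre of the pullback bundle over \<open>u\<close> is \<open>tangent_space M (fst u)\<close>; an element
  \<open>(u, v)\<close> is passed as two arguments, and sections are given by their second component.\<close>

definition pi_sections :: "('a, 'e::euclidean_space) chart set \<Rightarrow> ('a, 'e) tpoint set \<Rightarrow> ('a, 'e) pi_field set" where
  "pi_sections M U = {Y.
     (\<forall>u\<in>U. Y u \<in> tangent_space M (fst u)) \<and>
     (\<forall>c\<in>M. smooth_fun (slit_atlas M) (U \<inter> {u. fst u \<in> fst c}) (\<lambda>u. Y u c))}"

abbreviation pi_vector_fields :: "('a, 'e::euclidean_space) chart set \<Rightarrow> ('a, 'e) pi_field set" where
  "pi_vector_fields M \<equiv> pi_sections M (slit_bundle M)"

definition eta :: "('a, 'e) pi_field" where
  "eta u = snd u"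

definition vlift :: "('a, 'e::euclidean_space) chart set \<Rightarrow> ('a, 'e) tpoint \<Rightarrow> ('a, 'e) tvec \<Rightarrow> ('a, 'e) ttvec" where
  "vlift M u v = velocity (slit_atlas M) (\<lambda>t. (fst u, snd u + t *\<^sub>R v)) 0"

definition rho :: "('a, 'e::euclidean_space) chart set \<Rightarrow> ('a, 'e) tpoint \<Rightarrow> ('a, 'e) ttvec \<Rightarrow> ('a, 'e) tvec" where
  "rho M u \<xi> = differential (slit_atlas M) M fst u \<xi>"


section \<open>Connections on the pullback bundle\<close>

text \<open>\<open>D u \<xi> Y\<close> is the covariant derivative at \<open>u\<close> of the section \<open>Y\<close> along the tangent vector
  \<open>\<xi>\<close> at \<open>u\<close>. A connection acts on the sections over every open set \<open>U\<close>. Connections on global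
  sections are of this form, since they are local operators. Since sections over \<open>U\<close> are
  arbitrary outside \<open>U\<close>, the Leibniz rule forces \<open>D u \<xi> Y\<close> to depend only on the values of
  \<open>Y\<close> near \<open>u\<close>.\<close>

type_synonym ('a, 'e) connection =
  "('a, 'e) tpoint \<Rightarrow> ('a, 'e) ttvec \<Rightarrow> ('a, 'e) pi_field \<Rightarrow> ('a, 'e) tvec"

definition is_connection :: "('a, 'e::euclidean_space) chart set \<Rightarrow> ('a, 'e) connection \<Rightarrow> bool" where
  "is_connection M D \<longleftrightarrow> (\<forall>U. openin (atlas_topology (slit_atlas M)) U \<longrightarrow>
     (\<forall>Y\<in>pi_sections M U. \<forall>u\<in>U. \<forall>\<xi>\<in>tangent_space (slit_atlas M) u.
        D u \<xi> Y \<in> tangent_space M (fst u)) \<and>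
     (\<forall>Y\<in>pi_sections M U. \<forall>u\<in>U. \<forall>\<xi>\<in>tangent_space (slit_atlas M) u.
        \<forall>\<zeta>\<in>tangent_space (slit_atlas M) u. \<forall>a b.
        D u (a *\<^sub>R \<xi> + b *\<^sub>R \<zeta>) Y = a *\<^sub>R D u \<xi> Y + b *\<^sub>R D u \<zeta> Y) \<and>
     (\<forall>Y\<in>pi_sections M U. \<forall>Z\<in>pi_sections M U. \<forall>u\<in>U. \<forall>\<xi>\<in>tangent_space (slit_atlas M) u.
        D u \<xi> (\<lambda>w. Y w + Z w) = D u \<xi> Y + D u \<xi> Z) \<and>
     (\<forall>f. smooth_fun (slit_atlas M) U f \<longrightarrow>
        (\<forall>Y\<in>pi_sections M U. \<forall>u\<in>U. \<forall>\<xi>\<in>tangent_space (slit_atlas M) u.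
          D u \<xi> (\<lambda>w. f w *\<^sub>R Y w) =
            dir_deriv (slit_atlas M) u \<xi> f *\<^sub>R Y u + f u *\<^sub>R D u \<xi> Y)) \<and>
     (\<forall>X\<in>vector_fields (slit_atlas M) U. \<forall>Y\<in>pi_sections M U.
        (\<lambda>u. D u (X u) Y) \<in> pi_sections M U))"

definition connection_map ::
  "('a, 'e) connection \<Rightarrow> ('a, 'e) tpoint \<Rightarrow> ('a, 'e) ttvec \<Rightarrow> ('a, 'e) tvec" where
  "connection_map D u \<xi> = D u \<xi> eta"

definition horizontal_space ::
  "('a, 'e::euclidean_space) chart set \<Rightarrow> ('a, 'e) connection \<Rightarrow> ('a, 'e) tpoint \<Rightarrow> ('a, 'e) ttvec set" where
  "horizontal_space M D u = {\<xi> \<in> tangent_space (slit_atlas M) u. connection_map D u \<xi> = 0}"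

definition vertical_space ::
  "('a, 'e::euclidean_space) chart set \<Rightarrow> ('a, 'e) tpoint \<Rightarrow> ('a, 'e) ttvec set" where
  "vertical_space M u = {\<xi> \<in> tangent_space (slit_atlas M) u. rho M u \<xi> = 0}"

definition is_regular :: "('a, 'e::euclidean_space) chart set \<Rightarrow> ('a, 'e) connection \<Rightarrow> bool" where
  "is_regular M D \<longleftrightarrow> (\<forall>u\<in>slit_bundle M.
     {\<xi> + \<zeta> | \<xi> \<zeta>. \<xi> \<in> vertical_space M u \<and> \<zeta> \<in> horizontal_space M D u}
       = tangent_space (slit_atlas M) u \<and>
     vertical_space M u \<inter> horizontal_space M D u = {0})"

definition hlift ::
  "('a, 'e::euclidean_space) chart set \<Rightarrow> ('a, 'e) connection \<Rightarrow> ('a, 'e) tpoint \<Rightarrow> ('a, 'e) tvec \<Rightarrow> ('a, 'e) ttvec" where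
  "hlift M D u v = inv_into (horizontal_space M D u) (rho M u) v"

definition gamma_field ::
  "('a, 'e::euclidean_space) chart set \<Rightarrow> ('a, 'e) pi_field \<Rightarrow> ('a, 'e) tpoint \<Rightarrow> ('a, 'e) ttvec" where
  "gamma_field M X u = vlift M u (X u)"

definition beta_field ::
  "('a, 'e::euclidean_space) chart set \<Rightarrow> ('a, 'e) connection \<Rightarrow> ('a, 'e) pi_field
    \<Rightarrow> ('a, 'e) tpoint \<Rightarrow> ('a, 'e) ttvec" where
  "beta_field M D X u = hlift M D u (X u)"

definition torsion_form ::
  "('a, 'e::euclidean_space) chart set \<Rightarrow> ('a, 'e) connection
    \<Rightarrow> (('a, 'e) tpoint \<Rightarrow> ('a, 'e) ttvec) \<Rightarrow> (('a, 'e) tpoint \<Rightarrow> ('a, 'e) ttvec) \<Rightarrow> ('a, 'e) pi_field" where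
  "torsion_form M D X Y u =
     D u (X u) (\<lambda>w. rho M w (Y w)) - D u (Y u) (\<lambda>w. rho M w (X w))
     - rho M u (lie_bracket (slit_atlas M) X Y u)"

definition h_torsion ::
  "('a, 'e::euclidean_space) chart set \<Rightarrow> ('a, 'e) connection
    \<Rightarrow> ('a, 'e) pi_field \<Rightarrow> ('a, 'e) pi_field \<Rightarrow> ('a, 'e) pi_field" where
  "h_torsion M D X Y = torsion_form M D (beta_field M D X) (beta_field M D Y)"

definition mixed_torsion ::
  "('a, 'e::euclidean_space) chart set \<Rightarrow> ('a, 'e) connection
    \<Rightarrow> ('a, 'e) pi_field \<Rightarrow> ('a, 'e) pi_field \<Rightarrow> ('a, 'e) pi_field" where
  "mixed_torsion M D X Y = torsion_form M D (gamma_field M X) (beta_field M D Y)"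

text \<open>The sign convention is \<open>R(X, Y) = [D\<^sub>Y, D\<^sub>X] + D\<^bsub>[X, Y]\<^esub>\<close>.\<close>

definition curvature ::
  "('a, 'e::euclidean_space) chart set \<Rightarrow> ('a, 'e) connection
    \<Rightarrow> (('a, 'e) tpoint \<Rightarrow> ('a, 'e) ttvec) \<Rightarrow> (('a, 'e) tpoint \<Rightarrow> ('a, 'e) ttvec)
    \<Rightarrow> ('a, 'e) pi_field \<Rightarrow> ('a, 'e) pi_field" where
  "curvature M D X Y Z u =
     D u (Y u) (\<lambda>w. D w (X w) Z) - D u (X u) (\<lambda>w. D w (Y w) Z)
     + D u (lie_bracket (slit_atlas M) X Y u) Z"

definition mixed_curvature ::
  "('a, 'e::euclidean_space) chart set \<Rightarrow> ('a, 'e) connection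
    \<Rightarrow> ('a, 'e) pi_field \<Rightarrow> ('a, 'e) pi_field \<Rightarrow> ('a, 'e) pi_field \<Rightarrow> ('a, 'e) pi_field" where
  "mixed_curvature M D X Y Z = curvature M D (gamma_field M X) (beta_field M D Y) Z"


section \<open>Finsler structures and their Cartan connections\<close>

text \<open>\<open>fund_tensor L u\<close> is the Hessian at \<open>u\<close> of the restriction of \<open>L\<^sup>2 / 2\<close> to the fibre, as a
  bilinear form on that vector space.\<close>

definition fund_tensor ::
  "(('a, 'e::euclidean_space) tpoint \<Rightarrow> real) \<Rightarrow> ('a, 'e) tpoint \<Rightarrow> ('a, 'e) tvec \<Rightarrow> ('a, 'e) tvec \<Rightarrow> real" where
  "fund_tensor L u v w =
     deriv (\<lambda>s. deriv (\<lambda>t. (L (fst u, snd u + s *\<^sub>R v + t *\<^sub>R w))\<^sup>2 / 2) 0) 0"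

definition finsler_structure ::
  "('a, 'e::euclidean_space) chart set \<Rightarrow> (('a, 'e) tpoint \<Rightarrow> real) \<Rightarrow> bool" where
  "finsler_structure M L \<longleftrightarrow>
     (\<forall>u\<in>tangent_bundle M. 0 \<le> L u) \<and>
     smooth_fun (slit_atlas M) (slit_bundle M) L \<and>
     (\<forall>(p, v)\<in>tangent_bundle M. \<forall>a>0. L (p, a *\<^sub>R v) = a * L (p, v)) \<and>
     (\<forall>u\<in>slit_bundle M. \<forall>v\<in>tangent_space M (fst u). v \<noteq> 0 \<longrightarrow> 0 < fund_tensor L u v v)"

definition is_metric_connection ::
  "('a, 'e::euclidean_space) chart set \<Rightarrow> (('a, 'e) tpoint \<Rightarrow> real) \<Rightarrow> ('a, 'e) connection \<Rightarrow> bool" where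
  "is_metric_connection M L D \<longleftrightarrow>
     (\<forall>X\<in>vector_fields (slit_atlas M) (slit_bundle M).
      \<forall>Y\<in>pi_vector_fields M. \<forall>Z\<in>pi_vector_fields M. \<forall>u\<in>slit_bundle M.
        dir_deriv (slit_atlas M) u (X u) (\<lambda>w. fund_tensor L w (Y w) (Z w))
          = fund_tensor L u (D u (X u) Y) (Z u) + fund_tensor L u (Y u) (D u (X u) Z))"

definition is_cartan_connection ::
  "('a, 'e::euclidean_space) chart set \<Rightarrow> (('a, 'e) tpoint \<Rightarrow> real) \<Rightarrow> ('a, 'e) connection \<Rightarrow> bool" where
  "is_cartan_connection M L D \<longleftrightarrow>
     is_connection M D \<and> is_regular M D \<and> is_metric_connection M L D \<and>
     (\<forall>X\<in>pi_vector_fields M. \<forall>Y\<in>pi_vector_fields M. \<forall>u\<in>slit_bundle M.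
        h_torsion M D X Y u = 0) \<and>
     (\<forall>X\<in>pi_vector_fields M. \<forall>Y\<in>pi_vector_fields M. \<forall>Z\<in>pi_vector_fields M. \<forall>u\<in>slit_bundle M.
        fund_tensor L u (mixed_torsion M D X Y u) (Z u)
          = fund_tensor L u (mixed_torsion M D X Z u) (Y u))"

text \<open>To be used with \<open>D\<close> the Cartan connection of a Finsler structure \<open>L\<close> on \<open>M\<close>; it then says
  that \<open>(M, L)\<close> is a Landsberg manifold.\<close>

definition is_landsberg :: "('a, 'e::euclidean_space) chart set \<Rightarrow> ('a, 'e) connection \<Rightarrow> bool" where
  "is_landsberg M D \<longleftrightarrow>
     (\<forall>X\<in>pi_vector_fields M. \<forall>Y\<in>pi_vector_fields M. \<forall>u\<in>slit_bundle M.
        mixed_curvature M D X Y eta u = 0)"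

text \<open>The difference tensor \<open>B\<close>; the horizontal lift is that of \<open>D\<close>.\<close>

definition difference_tensor ::
  "('a, 'e::euclidean_space) chart set \<Rightarrow> ('a, 'e) connection \<Rightarrow> ('a, 'e) connection
    \<Rightarrow> ('a, 'e) pi_field \<Rightarrow> ('a, 'e) pi_field \<Rightarrow> ('a, 'e) pi_field" where
  "difference_tensor M D D' X Y u = D' u (beta_field M D X u) Y - D u (beta_field M D X u) Y"

end

theory Submission
  imports Defs
begin

text \<open>Write \<open>K\<close>, \<open>\<beta>\<close>, \<open>P\<close> and \<open>K\<^sup>*\<close>, \<open>\<beta>\<^sup>*\<close>, \<open>P\<^sup>*\<close> for the connection maps, horizontal lifts and mixed
  curvatures of the two Cartan connections. When \<open>B\<close> vanishes, even
  \<open>P\<^sup>*(X, Y)\<eta> = P(X, Y)\<eta>\<close> holds for all \<open>X\<close> and \<open>Y\<close>.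

  The reason is the formula \<open>P(X, Y)\<eta> = \<nabla>\<^bsub>\<beta>Y\<^esub> X + K[\<gamma>X, \<beta>Y]\<close> of \<open>mixed_curvature_eta\<close>, which
  follows from \<open>\<nabla>\<^bsub>\<gamma>X\<^esub> \<eta> = K\<gamma>X = X\<close> and \<open>\<nabla>\<^bsub>\<beta>Y\<^esub> \<eta> = K\<beta>Y = 0\<close>. The hypothesis, applied to the section
  \<open>\<eta>\<close>, gives \<open>K\<^sup>*\<beta>X = K\<beta>X = 0\<close>, so that \<open>\<beta>X\<close> is horizontal for both connections and
  \<open>\<beta>\<^sup>* = \<beta>\<close>. As \<open>K\<close> and \<open>K\<^sup>*\<close> agree on horizontal and on vertical lifts, they are equal, and every
  ingredient of the formula is the same for the two connections.

  The real content is \<open>K\<gamma>X = X\<close> (\<open>K_gamma\<close>). It follows from three facts: the metric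
  condition, the symmetry of the mixed torsion, and the Euler relation
  \<open>g(\<eta>, Z) = dE(\<gamma>Z)\<close> for the energy \<open>E = L\<^sup>2 / 2\<close> (\<open>fund_tensor_eta\<close>). To
  compute the mixed torsion one differentiates the components of \<open>\<beta>Z\<close>, so that horizontal lifts
  have to be shown smooth (\<open>beta_vector_field\<close>); in a chart they solve a linear system with smooth
  coefficients, and Cramer's rule applies.

  The metric and torsion conditions speak about global sections only, and a tangent vector is not
  extended to a global section here. Instead the value of \<open>\<Xi> = [\<gamma>X, \<beta>Y]\<close> at a point is decomposed
  as the value of \<open>\<gamma>(K\<Xi>) + \<beta>(\<rho>\<Xi>)\<close>, where \<open>K\<Xi>\<close> and \<open>\<rho>\<Xi>\<close> are global sections because the
  bracket is again a smooth vector field (\<open>lie_bracket_vector_field\<close>). That the bracket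
  transforms as a vector field rests on the symmetry of second derivatives of the coordinate changes
  of the slit bundle.\<close>

section \<open>Calculus of smooth functions on open sets\<close>

lemma frechet_derivativeI:
  "(f has_derivative f') (at x) \<Longrightarrow> frechet_derivative f (at x) = f'"
  using frechet_derivative_at by metis

text \<open>Smooth functions are only ever compared on open sets, and the operator
  \<^const>\<open>frechet_derivative\<close> is a choice; this lemma lets one replace a function by a formula
  for it that holds near the point.\<close>

lemma frechet_derivative_local:
  assumes "open S" "x \<in> S" "\<And>y. y \<in> S \<Longrightarrow> f y = g y"
  shows "frechet_derivative f (at x) = frechet_derivative g (at x)"
proof -
  have "(f has_derivative f') (at x) \<longleftrightarrow> (g has_derivative f') (at x)" for f'
    using has_derivative_transform_within_open[OF _ assms(1,2), of f f' UNIV g]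
      has_derivative_transform_within_open[OF _ assms(1,2), of g f' UNIV f] assms(3)
    by auto
  then show ?thesis
    by (simp add: frechet_derivative_def)
qed

lemma ck_on_SucD: "ck_on (Suc k) S f \<Longrightarrow> ck_on k S f"
proof (induction k arbitrary: f)
  case 0
  then show ?case
    by (auto intro!: continuous_at_imp_continuous_on differentiable_imp_continuous_within)
next
  case (Suc k)
  then show ?case by (metis ck_on.simps(2))
qed

lemma ck_on_subset: "ck_on k S f \<Longrightarrow> T \<subseteq> S \<Longrightarrow> ck_on k T f"
  by (induction k arbitrary: f) (auto intro: continuous_on_subset)

lemma ck_on_cong:
  assumes "open S" "\<And>x. x \<in> S \<Longrightarrow> f x = g x" "ck_on k S f"
  shows "ck_on k S g"
  using assms(2,3)
proof (induction k arbitrary: f g)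
  case 0
  then show ?case by (simp cong: continuous_on_cong)
next
  case (Suc k)
  have "g differentiable (at x)" if "x \<in> S" for x
  proof -
    have "(f has_derivative frechet_derivative f (at x)) (at x)"
      using Suc.prems that by (auto simp: frechet_derivative_works)
    then have "(g has_derivative frechet_derivative f (at x)) (at x)"
      using has_derivative_transform_within_open[OF _ assms(1) that] Suc.prems(1) by auto
    then show ?thesis by (auto simp: differentiable_def)
  qed
  moreover have "ck_on k S (\<lambda>x. frechet_derivative g (at x) v)" for v
  proof (rule Suc.IH)
    show "ck_on k S (\<lambda>x. frechet_derivative f (at x) v)" using Suc.prems by simp
    show "frechet_derivative f (at x) v = frechet_derivative g (at x) v" if "x \<in> S" for x
      using frechet_derivative_local[OF assms(1) that Suc.prems(1)] by simp
  qed
  ultimately show ?case by simp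
qed

lemma ck_on_SucI:
  assumes "open S" "\<And>x. x \<in> S \<Longrightarrow> (f has_derivative f' x) (at x)"
    "\<And>v. ck_on k S (\<lambda>x. f' x v)"
  shows "ck_on (Suc k) S f"
proof -
  have "frechet_derivative f (at x) = f' x" if "x \<in> S" for x
    using assms(2)[OF that] by (rule frechet_derivativeI)
  then have "ck_on k S (\<lambda>x. frechet_derivative f (at x) v)" for v
    using ck_on_cong[OF assms(1) _ assms(3)[of v]] by simp
  then show ?thesis
    using assms(2) by (auto simp: differentiable_def)
qed

lemma ck_on_const [simp]: "ck_on k S (\<lambda>x. c)"
  by (induction k arbitrary: c) auto

lemma ck_on_linear:
  assumes "bounded_linear f" shows "ck_on k S f"
proof (cases k)
  case 0
  then show ?thesis using assms by (simp add: linear_continuous_on)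
next
  case (Suc l)
  have "(f has_derivative f) (at x)" for x
    using assms by (rule bounded_linear_imp_has_derivative)
  then show ?thesis
    using Suc frechet_derivativeI[OF \<open>\<And>x. (f has_derivative f) (at x)\<close>] 
    by (auto simp: differentiable_def)
qed

lemma ck_on_has_derivative:
  "ck_on (Suc k) S f \<Longrightarrow> x \<in> S \<Longrightarrow> (f has_derivative frechet_derivative f (at x)) (at x)"
  by (auto simp: frechet_derivative_works)

lemma ck_on_add:
  assumes "open S" "ck_on k S f" "ck_on k S g"
  shows "ck_on k S (\<lambda>x. f x + g x)"
  using assms(2,3)
proof (induction k arbitrary: f g)
  case 0
  then show ?case by (auto intro: continuous_intros)
next
  case (Suc k)
  show ?case
    by (rule ck_on_SucI[OF assms(1)], rule has_derivative_add[OF ck_on_has_derivative[OF Suc.prems(1)] ck_on_has_derivative[OF Suc.prems(2)]])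
      (use Suc in auto)
qed

lemma ck_on_bilinear:
  assumes "bounded_bilinear p" "open S" "ck_on k S f" "ck_on k S g"
  shows "ck_on k S (\<lambda>x. p (f x) (g x))"
  using assms(3,4)
proof (induction k arbitrary: f g)
  case 0
  then show ?case by (auto intro: bounded_bilinear.continuous_on[OF assms(1)])
next
  case (Suc k)
  have fg: "ck_on k S f" "ck_on k S g" using Suc.prems by (auto intro: ck_on_SucD)
  show ?case
    by (rule ck_on_SucI[OF assms(2)], rule bounded_bilinear.FDERIV[OF assms(1) ck_on_has_derivative[OF Suc.prems(1)] ck_on_has_derivative[OF Suc.prems(2)]])
      (use Suc fg in \<open>auto intro!: ck_on_add[OF assms(2)]\<close>)
qed

lemma ck_on_linear_compose:
  assumes "bounded_linear h" "open S" "ck_on k S f"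
  shows "ck_on k S (\<lambda>x. h (f x))"
  using assms(3)
proof (induction k arbitrary: f)
  case 0
  then show ?case by (auto intro: bounded_linear.continuous_on[OF assms(1)])
next
  case (Suc k)
  show ?case
    by (rule ck_on_SucI[OF assms(2)], rule bounded_linear.has_derivative[OF assms(1) ck_on_has_derivative[OF Suc.prems]])
      (use Suc in auto)
qed

lemma ck_on_sum:
  assumes "open S" "\<And>i. i \<in> I \<Longrightarrow> ck_on k S (f i)"
  shows "ck_on k S (\<lambda>x. \<Sum>i\<in>I. f i x)"
  using assms(2) by (induction I rule: infinite_finite_induct) (auto intro!: ck_on_add assms(1))

lemma linear_euclidean_sum:
  fixes f :: "'e::euclidean_space \<Rightarrow> 'f::real_vector"
  assumes "linear f"
  shows "f v = (\<Sum>b\<in>Basis. (v \<bullet> b) *\<^sub>R f b)"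
  using linear_sum[OF assms, of "\<lambda>b. (v \<bullet> b) *\<^sub>R b" Basis] linear_scale[OF assms]
  by (simp add: euclidean_representation)

text \<open>The chain rule expresses the derivative of a composite through the partial derivatives of
  the outer function, which turns composition into products and makes the induction on the
  order of differentiability go through.\<close>

lemma ck_on_compose:
  fixes f :: "'e::real_normed_vector \<Rightarrow> 'f::euclidean_space" and g :: "'f \<Rightarrow> 'g::real_normed_vector"
  assumes "open S" "open T" "f ` S \<subseteq> T" "ck_on k S f" "ck_on k T g"
  shows "ck_on k S (\<lambda>x. g (f x))"
  using assms(4,5)
proof (induction k arbitrary: g)
  case 0
  then show ?case using assms(3) by (auto intro: continuous_on_compose2)
next
  case (Suc k)
  show ?case
  proof (rule ck_on_SucI[OF assms(1)])
    fix x assume x: "x \<in> S"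
    let ?d = "\<lambda>v. \<Sum>b\<in>Basis. (frechet_derivative f (at x) v \<bullet> b) *\<^sub>R frechet_derivative g (at (f x)) b"
    have g: "(g has_derivative frechet_derivative g (at (f x))) (at (f x))"
      using x assms(3) by (intro ck_on_has_derivative[OF Suc.prems(2)]) auto
    have "((\<lambda>x. g (f x)) has_derivative (\<lambda>v. frechet_derivative g (at (f x)) (frechet_derivative f (at x) v))) (at x)"
      using has_derivative_compose[OF ck_on_has_derivative[OF Suc.prems(1) x] g] .
    then show "((\<lambda>x. g (f x)) has_derivative ?d) (at x)"
      by (rule has_derivative_eq_rhs) (rule ext, rule linear_euclidean_sum[OF has_derivative_linear[OF g]])
  next
    fix v
    show "ck_on k S (\<lambda>x. \<Sum>b\<in>Basis. (frechet_derivative f (at x) v \<bullet> b) *\<^sub>R frechet_derivative g (at (f x)) b)"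
    proof (rule ck_on_sum[OF assms(1)], rule ck_on_bilinear[OF bounded_bilinear_scaleR assms(1)])
      fix b :: 'f
      show "ck_on k S (\<lambda>x. frechet_derivative f (at x) v \<bullet> b)"
        using Suc.prems(1) by (intro ck_on_linear_compose[OF bounded_linear_inner_left assms(1)]) auto
      show "ck_on k S (\<lambda>x. frechet_derivative g (at (f x)) b)"
        using Suc.prems by (intro Suc.IH ck_on_SucD[OF Suc.prems(1)]) auto
    qed
  qed
qed

text \<open>The derivative of \<open>1 / f\<close> is a polynomial in \<open>1 / f\<close> and the derivative of \<open>f\<close>, so each order
  of differentiability follows from the one below.\<close>

lemma ck_on_inverse:
  assumes "open S" "ck_on k S f" "\<And>x. x \<in> S \<Longrightarrow> f x \<noteq> 0"
  shows "ck_on k S (\<lambda>x. inverse (f x :: real))"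
  using assms(2)
proof (induction k)
  case 0
  then show ?case using assms(3) by (auto intro: continuous_intros)
next
  case (Suc k)
  have IH: "ck_on k S (\<lambda>x. inverse (f x))" by (rule Suc.IH[OF ck_on_SucD[OF Suc.prems]])
  show ?case
  proof (rule ck_on_SucI[OF assms(1)])
    fix x assume "x \<in> S"
    then show "((\<lambda>x. inverse (f x)) has_derivative
       (\<lambda>v. - (inverse (f x) * frechet_derivative f (at x) v * inverse (f x)))) (at x)"
      using assms(3) by (intro Deriv.has_derivative_inverse ck_on_has_derivative[OF Suc.prems])
  next
    fix v
    have "ck_on k S (\<lambda>x. inverse (f x) * frechet_derivative f (at x) v)"
      using Suc.prems by (intro ck_on_bilinear[OF bounded_bilinear_mult assms(1) IH]) auto
    then have "ck_on k S (\<lambda>x. inverse (f x) * frechet_derivative f (at x) v * inverse (f x))"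
      by (rule ck_on_bilinear[OF bounded_bilinear_mult assms(1) _ IH])
    then show "ck_on k S (\<lambda>x. - (inverse (f x) * frechet_derivative f (at x) v * inverse (f x)))"
      by (rule ck_on_linear_compose[OF bounded_linear_minus[OF bounded_linear_ident] assms(1)])
  qed
qed

lemma smooth_on_const: "smooth_on S (\<lambda>x. c)"
  by (simp add: smooth_on_def)

lemma smooth_on_linear: "bounded_linear f \<Longrightarrow> smooth_on S f"
  by (simp add: smooth_on_def ck_on_linear)

lemma smooth_on_subset: "smooth_on S f \<Longrightarrow> T \<subseteq> S \<Longrightarrow> smooth_on T f"
  by (auto simp: smooth_on_def intro: ck_on_subset)

lemma smooth_on_cong:
  "open S \<Longrightarrow> (\<And>x. x \<in> S \<Longrightarrow> f x = g x) \<Longrightarrow> smooth_on S f \<Longrightarrow> smooth_on S g"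
  using ck_on_cong by (metis smooth_on_def)

lemma smooth_on_add:
  "open S \<Longrightarrow> smooth_on S f \<Longrightarrow> smooth_on S g \<Longrightarrow> smooth_on S (\<lambda>x. f x + g x)"
  by (simp add: smooth_on_def ck_on_add)

lemma smooth_on_bilinear:
  "bounded_bilinear p \<Longrightarrow> open S \<Longrightarrow> smooth_on S f \<Longrightarrow> smooth_on S g
    \<Longrightarrow> smooth_on S (\<lambda>x. p (f x) (g x))"
  by (simp add: smooth_on_def ck_on_bilinear)

lemma smooth_on_linear_compose:
  "bounded_linear h \<Longrightarrow> open S \<Longrightarrow> smooth_on S f \<Longrightarrow> smooth_on S (\<lambda>x. h (f x))"
  by (simp add: smooth_on_def ck_on_linear_compose)

lemma smooth_on_minus:
  "open S \<Longrightarrow> smooth_on S f \<Longrightarrow> smooth_on S (\<lambda>x. - f x)"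
  by (rule smooth_on_linear_compose[OF bounded_linear_minus[OF bounded_linear_ident]])

lemma smooth_on_diff:
  "open S \<Longrightarrow> smooth_on S f \<Longrightarrow> smooth_on S g \<Longrightarrow> smooth_on S (\<lambda>x. f x - g x)"
  using smooth_on_add[OF _ _ smooth_on_minus, of S f g] by simp

lemma smooth_on_sum:
  "open S \<Longrightarrow> (\<And>i. i \<in> I \<Longrightarrow> smooth_on S (f i)) \<Longrightarrow> smooth_on S (\<lambda>x. \<Sum>i\<in>I. f i x)"
  by (simp add: smooth_on_def ck_on_sum)

lemma smooth_on_prod:
  fixes f :: "'i \<Rightarrow> 'e::real_normed_vector \<Rightarrow> real"
  assumes "open S" "\<And>i. i \<in> I \<Longrightarrow> smooth_on S (f i)"
  shows "smooth_on S (\<lambda>x. \<Prod>i\<in>I. f i x)"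
  using assms(2)
  by (induction I rule: infinite_finite_induct)
    (auto intro!: smooth_on_const smooth_on_bilinear[OF bounded_bilinear_mult assms(1)])

lemma smooth_on_compose:
  fixes f :: "'e::real_normed_vector \<Rightarrow> 'f::euclidean_space" and g :: "'f \<Rightarrow> 'g::real_normed_vector"
  shows "open S \<Longrightarrow> open T \<Longrightarrow> f ` S \<subseteq> T \<Longrightarrow> smooth_on S f \<Longrightarrow> smooth_on T g
    \<Longrightarrow> smooth_on S (\<lambda>x. g (f x))"
  unfolding smooth_on_def by (blast intro: ck_on_compose)

lemma smooth_on_divide:
  assumes "open S" "smooth_on S f" "smooth_on S g" "\<And>x. x \<in> S \<Longrightarrow> g x \<noteq> (0::real)"
  shows "smooth_on S (\<lambda>x. f x / g x)"
  using assms smooth_on_bilinear[OF bounded_bilinear_mult assms(1), of f "\<lambda>x. inverse (g x)"]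
  by (simp add: smooth_on_def divide_inverse ck_on_inverse)

lemma smooth_on_Pair:
  assumes "open S" "smooth_on S f" "smooth_on S g"
  shows "smooth_on S (\<lambda>x. (f x, g x))"
proof -
  have "smooth_on S (\<lambda>x. (f x, 0) + (0, g x))"
    using assms
    by (intro smooth_on_add smooth_on_linear_compose[of "\<lambda>y. (y, 0)"]
        smooth_on_linear_compose[of "\<lambda>y. (0, y)"] bounded_linear_Pair bounded_linear_ident bounded_linear_zero)
  then show ?thesis by simp
qed

lemma smooth_on_vec_iff:
  fixes f :: "'e::real_normed_vector \<Rightarrow> real ^ 'n"
  assumes "open S"
  shows "smooth_on S f \<longleftrightarrow> (\<forall>i. smooth_on S (\<lambda>x. f x $ i))"
proof
  assume "smooth_on S f"
  then show "\<forall>i. smooth_on S (\<lambda>x. f x $ i)"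
    using smooth_on_linear_compose[OF bounded_linear_vec_nth assms] by blast
next
  assume *: "\<forall>i. smooth_on S (\<lambda>x. f x $ i)"
  have "smooth_on S (\<lambda>x. \<Sum>i\<in>UNIV. f x $ i *\<^sub>R axis i (1::real))"
    using * by (intro smooth_on_sum[OF assms] smooth_on_bilinear[OF bounded_bilinear_scaleR assms]
        smooth_on_const) auto
  moreover have "(\<Sum>i\<in>UNIV. f x $ i *\<^sub>R axis i (1::real)) = f x" for x
    using basis_expansion[of "f x"] by (simp add: scalar_mult_eq_scaleR)
  ultimately show "smooth_on S f" by simp
qed

lemma smooth_on_det:
  fixes F :: "'e::real_normed_vector \<Rightarrow> real ^ 'n ^ 'n"
  assumes "open S" "\<And>i j. smooth_on S (\<lambda>x. F x $ i $ j)"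
  shows "smooth_on S (\<lambda>x. det (F x))"
  unfolding det_def
  using assms by (intro smooth_on_sum smooth_on_bilinear[OF bounded_bilinear_mult] smooth_on_const smooth_on_prod)

lemma smooth_on_has_derivative:
  "smooth_on S f \<Longrightarrow> x \<in> S \<Longrightarrow> (f has_derivative frechet_derivative f (at x)) (at x)"
  using ck_on_has_derivative by (metis smooth_on_def)

lemma smooth_on_linear_derivative:
  "smooth_on S f \<Longrightarrow> x \<in> S \<Longrightarrow> linear (frechet_derivative f (at x))"
  using smooth_on_has_derivative has_derivative_linear by blast

lemma smooth_on_partial: "smooth_on S f \<Longrightarrow> smooth_on S (\<lambda>x. frechet_derivative f (at x) v)"
  by (metis ck_on.simps(2) smooth_on_def)

text \<open>Directional derivatives are smooth for a fixed direction. Expanding the direction in a basis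
  reduces a direction that varies with the point to finitely many fixed ones.\<close>

lemma derivative_basis_expansion:
  fixes f :: "'e::euclidean_space \<Rightarrow> 'f::real_normed_vector"
  assumes "smooth_on S f" "x \<in> S"
  shows "frechet_derivative f (at x) v = (\<Sum>b\<in>Basis. (v \<bullet> b) *\<^sub>R frechet_derivative f (at x) b)"
  using linear_euclidean_sum[OF smooth_on_linear_derivative[OF assms]] .

lemma smooth_on_derivative_along:
  fixes f :: "'e::euclidean_space \<Rightarrow> 'f::real_normed_vector" and v :: "'e \<Rightarrow> 'e"
  assumes "open S" "smooth_on S f" "smooth_on S v"
  shows "smooth_on S (\<lambda>x. frechet_derivative f (at x) (v x))"
proof (rule smooth_on_cong[OF assms(1)])
  show "smooth_on S (\<lambda>x. \<Sum>b\<in>Basis. (v x \<bullet> b) *\<^sub>R frechet_derivative f (at x) b)"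
    using assms by (intro smooth_on_sum smooth_on_bilinear[OF bounded_bilinear_scaleR]
        smooth_on_linear_compose[OF bounded_linear_inner_left] smooth_on_partial)
  show "(\<Sum>b\<in>Basis. (v x \<bullet> b) *\<^sub>R frechet_derivative f (at x) b) = frechet_derivative f (at x) (v x)"
    if "x \<in> S" for x using derivative_basis_expansion[OF assms(2) that] by (rule sym)
qed

lemma has_derivative_derivative_along:
  fixes f :: "'e::euclidean_space \<Rightarrow> 'f::real_normed_vector"
  assumes "open S" "smooth_on S f" "x \<in> S" "(v has_derivative v') (at x)"
  shows "((\<lambda>x. frechet_derivative f (at x) (v x)) has_derivative
    (\<lambda>h. frechet_derivative (\<lambda>y. frechet_derivative f (at y) (v x)) (at x) h
       + frechet_derivative f (at x) (v' h))) (at x)"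
proof -
  let ?p = "\<lambda>b x. frechet_derivative f (at x) b"
  have p: "(?p b has_derivative frechet_derivative (?p b) (at x)) (at x)" for b
    using smooth_on_has_derivative[OF smooth_on_partial[OF assms(2)] assms(3)] .
  have 1: "((\<lambda>y. \<Sum>b\<in>Basis. (w \<bullet> b) *\<^sub>R ?p b y) has_derivative
      (\<lambda>h. \<Sum>b\<in>Basis. (w \<bullet> b) *\<^sub>R frechet_derivative (?p b) (at x) h)) (at x)" for w
    by (intro has_derivative_sum has_derivative_scaleR_right p)
  have 2: "frechet_derivative (?p w) (at x) h
      = (\<Sum>b\<in>Basis. (w \<bullet> b) *\<^sub>R frechet_derivative (?p b) (at x) h)" for w h
  proof -
    have "frechet_derivative (?p w) (at x)
       = frechet_derivative (\<lambda>y. \<Sum>b\<in>Basis. (w \<bullet> b) *\<^sub>R ?p b y) (at x)"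
      by (rule frechet_derivative_local[OF assms(1,3)]) (rule derivative_basis_expansion[OF assms(2)])
    then show ?thesis using frechet_derivativeI[OF 1] by simp
  qed
  have "((\<lambda>y. \<Sum>b\<in>Basis. (v y \<bullet> b) *\<^sub>R ?p b y) has_derivative
      (\<lambda>h. \<Sum>b\<in>Basis. (v x \<bullet> b) *\<^sub>R frechet_derivative (?p b) (at x) h + (v' h \<bullet> b) *\<^sub>R ?p b x)) (at x)"
    by (intro has_derivative_sum has_derivative_scaleR p has_derivative_inner_left assms(4))
  moreover have "(\<lambda>h. \<Sum>b\<in>Basis. (v x \<bullet> b) *\<^sub>R frechet_derivative (?p b) (at x) h + (v' h \<bullet> b) *\<^sub>R ?p b x)
    = (\<lambda>h. frechet_derivative (?p (v x)) (at x) h + frechet_derivative f (at x) (v' h))"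
    unfolding 2[of "v x"] sum.distrib
    by (rule ext, rule arg_cong2[of _ _ _ _ "(+)"], rule refl, rule sym)
      (rule derivative_basis_expansion[OF assms(2,3)])
  ultimately have "((\<lambda>y. \<Sum>b\<in>Basis. (v y \<bullet> b) *\<^sub>R ?p b y) has_derivative
    (\<lambda>h. frechet_derivative (?p (v x)) (at x) h + frechet_derivative f (at x) (v' h))) (at x)"
    by simp
  then show ?thesis
    by (rule has_derivative_transform_within_open[OF _ assms(1,3)])
      (rule sym, rule derivative_basis_expansion[OF assms(2)])
qed

text \<open>The mean value theorem is applied first in the direction \<open>a\<close>, to the increment of \<open>f\<close> along
  \<open>h b\<close>, and then in the direction \<open>b\<close>. The second difference is symmetric in \<open>a\<close> and \<open>b\<close>, which
  is what makes it useful below.\<close>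

lemma second_difference:
  fixes f :: "'e::euclidean_space \<Rightarrow> real"
  assumes "smooth_on (ball x r) f" "0 < h" "h * (norm a + norm b) < r"
  obtains s t where "0 < s" "s < h" "0 < t" "t < h"
    "f (x + h *\<^sub>R a + h *\<^sub>R b) - f (x + h *\<^sub>R a) - f (x + h *\<^sub>R b) + f x
      = h * h * frechet_derivative (\<lambda>y. frechet_derivative f (at y) a) (at (x + s *\<^sub>R a + t *\<^sub>R b)) b"
proof -
  have inB: "x + s *\<^sub>R a + t *\<^sub>R b \<in> ball x r" if "0 \<le> s" "s \<le> h" "0 \<le> t" "t \<le> h" for s t
  proof -
    have "norm (s *\<^sub>R a + t *\<^sub>R b) \<le> s * norm a + t * norm b"
      using that norm_triangle_ineq[of "s *\<^sub>R a" "t *\<^sub>R b"] by simp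
    also have "\<dots> \<le> h * norm a + h * norm b"
      using that by (intro add_mono mult_right_mono) auto
    also have "\<dots> < r" using assms(3) by (simp add: algebra_simps)
    finally show ?thesis by (simp add: dist_norm algebra_simps norm_minus_commute)
  qed
  let ?fa = "\<lambda>y. frechet_derivative f (at y) a"
  let ?g = "\<lambda>s. f (x + s *\<^sub>R a + h *\<^sub>R b) - f (x + s *\<^sub>R a)"
  have D1: "((\<lambda>s. f (x + s *\<^sub>R a + t *\<^sub>R b)) has_derivative (\<lambda>k. k * ?fa (x + s *\<^sub>R a + t *\<^sub>R b))) (at s)"
    if "0 \<le> s" "s \<le> h" "0 \<le> t" "t \<le> h" for s t
  proof -
    let ?z = "x + s *\<^sub>R a + t *\<^sub>R b"
    have l: "linear (frechet_derivative f (at ?z))"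
      by (rule smooth_on_linear_derivative[OF assms(1) inB[OF that]])
    have "((\<lambda>s. x + s *\<^sub>R a + t *\<^sub>R b) has_derivative (\<lambda>k. k *\<^sub>R a)) (at s)"
      by (auto intro!: derivative_eq_intros)
    from has_derivative_compose[OF this smooth_on_has_derivative[OF assms(1) inB[OF that]]]
    show ?thesis by (simp add: linear_scale[OF l])
  qed
  have "\<exists>s. 0 < s \<and> s < h \<and> ?g h - ?g 0
      = (h - 0) * (?fa (x + s *\<^sub>R a + h *\<^sub>R b) - ?fa (x + s *\<^sub>R a))"
  proof (rule MVT2[OF assms(2)])
    fix s assume "0 \<le> s" "s \<le> h"
    then have "(?g has_derivative (\<lambda>k. k * ?fa (x + s *\<^sub>R a + h *\<^sub>R b) - k * ?fa (x + s *\<^sub>R a))) (at s)"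
      using D1[of s h] D1[of s 0] assms(2) by (intro has_derivative_diff) auto
    then show "(?g has_real_derivative ?fa (x + s *\<^sub>R a + h *\<^sub>R b) - ?fa (x + s *\<^sub>R a)) (at s)"
      unfolding has_field_derivative_def by (rule has_derivative_eq_rhs) (simp add: fun_eq_iff algebra_simps)
  qed
  then obtain s where s: "0 < s" "s < h" "?g h - ?g 0 = h * (?fa (x + s *\<^sub>R a + h *\<^sub>R b) - ?fa (x + s *\<^sub>R a))"
    by auto
  let ?fab = "\<lambda>y. frechet_derivative ?fa (at y) b"
  have sm: "smooth_on (ball x r) ?fa" using assms(1) by (rule smooth_on_partial)
  have D2: "((\<lambda>t. ?fa (x + s *\<^sub>R a + t *\<^sub>R b)) has_real_derivative ?fab (x + s *\<^sub>R a + t *\<^sub>R b)) (at t)"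
    if "0 \<le> t" "t \<le> h" for t
  proof -
    let ?z = "x + s *\<^sub>R a + t *\<^sub>R b"
    have z: "?z \<in> ball x r" using inB s that by auto
    have l: "linear (frechet_derivative ?fa (at ?z))"
      by (rule smooth_on_linear_derivative[OF sm z])
    have "((\<lambda>t. x + s *\<^sub>R a + t *\<^sub>R b) has_derivative (\<lambda>k. k *\<^sub>R b)) (at t)"
      by (auto intro!: derivative_eq_intros)
    from has_derivative_compose[OF this smooth_on_has_derivative[OF sm z]]
    show ?thesis unfolding has_field_derivative_def
      by (rule has_derivative_eq_rhs) (simp add: linear_scale[OF l] fun_eq_iff)
  qed
  have "\<exists>t. 0 < t \<and> t < h \<and> ?fa (x + s *\<^sub>R a + h *\<^sub>R b) - ?fa (x + s *\<^sub>R a + 0 *\<^sub>R b)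
      = (h - 0) * ?fab (x + s *\<^sub>R a + t *\<^sub>R b)"
    by (rule MVT2[OF assms(2)]) (use D2 in auto)
  then obtain t where t: "0 < t" "t < h"
    "?fa (x + s *\<^sub>R a + h *\<^sub>R b) - ?fa (x + s *\<^sub>R a) = h * ?fab (x + s *\<^sub>R a + t *\<^sub>R b)"
    by auto
  show ?thesis using that[OF s(1,2) t(1,2)] s(3) t(3) by (simp add: algebra_simps)
qed

text \<open>Schwarz's theorem: the second difference divided by \<open>h\<^sup>2\<close> is a value of either mixed
  derivative at a point near \<open>x\<close>. If the two differed at \<open>x\<close>, continuity would keep these values
  apart on a small ball.\<close>

lemma symmetric_second_derivative_real:
  fixes f :: "'e::euclidean_space \<Rightarrow> real"
  assumes "open S" "smooth_on S f" "x \<in> S"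
  shows "frechet_derivative (\<lambda>y. frechet_derivative f (at y) a) (at x) b
       = frechet_derivative (\<lambda>y. frechet_derivative f (at y) b) (at x) a"
proof (rule ccontr)
  let ?F = "\<lambda>a b z. frechet_derivative (\<lambda>y. frechet_derivative f (at y) a) (at z) b"
  assume "?F a b x \<noteq> ?F b a x"
  define e where "e = \<bar>?F a b x - ?F b a x\<bar> / 2"
  have e: "e > 0" using \<open>?F a b x \<noteq> ?F b a x\<close> by (simp add: e_def)
  have cont: "continuous (at x) (?F a b)" for a b
    using smooth_on_has_derivative[OF smooth_on_partial[OF smooth_on_partial[OF assms(2)]] assms(3)]
    by (rule has_derivative_continuous)
  obtain d1 where d1: "d1 > 0" "\<And>z. dist z x < d1 \<Longrightarrow> dist (?F a b z) (?F a b x) < e"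
    using cont[of a b] e unfolding continuous_at_eps_delta by (meson dist_commute)
  obtain d2 where d2: "d2 > 0" "\<And>z. dist z x < d2 \<Longrightarrow> dist (?F b a z) (?F b a x) < e"
    using cont[of b a] e unfolding continuous_at_eps_delta by (meson dist_commute)
  obtain d3 where d3: "d3 > 0" "ball x d3 \<subseteq> S" using assms(1,3) open_contains_ball by blast
  define r where "r = min d1 (min d2 d3)"
  have r: "r > 0" "r \<le> d1" "r \<le> d2" "r \<le> d3" using d1 d2 d3 by (auto simp: r_def)
  have sm: "smooth_on (ball x r) f" using smooth_on_subset[OF assms(2)] d3 r(4) by (meson subset_ball subset_trans)
  \<comment> \<open>The parallelogram spanned by \<open>h a\<close> and \<open>h b\<close> stays within distance \<open>r\<close> of \<open>x\<close>; the summand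
    \<open>1\<close> covers the case of zero vectors.\<close>
  define h where "h = r / (norm a + norm b + 1)"
  have n: "norm a + norm b + 1 > 0" by (simp add: add_nonneg_pos)
  then have h: "0 < h" using r by (simp add: h_def)
  have "h * (norm a + norm b + 1) = r" using n by (simp add: h_def)
  with h have hr: "h * (norm a + norm b) < r" "h * (norm b + norm a) < r"
    by (auto simp: algebra_simps)
  have near: "dist (x + s *\<^sub>R v + t *\<^sub>R w) x < r" if "0 < s" "s < h" "0 < t" "t < h" "h * (norm v + norm w) < r"
    for s t and v w :: 'e
  proof -
    have "norm (s *\<^sub>R v + t *\<^sub>R w) \<le> s * norm v + t * norm w"
      using that norm_triangle_ineq[of "s *\<^sub>R v" "t *\<^sub>R w"] by simp
    also have "\<dots> \<le> h * norm v + h * norm w"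
      using that by (intro add_mono mult_right_mono) auto
    finally show ?thesis using that(5) by (simp add: dist_norm algebra_simps)
  qed
  obtain s t where 1: "0 < s" "s < h" "0 < t" "t < h"
    "f (x + h *\<^sub>R a + h *\<^sub>R b) - f (x + h *\<^sub>R a) - f (x + h *\<^sub>R b) + f x
      = h * h * ?F a b (x + s *\<^sub>R a + t *\<^sub>R b)"
    using second_difference[OF sm h hr(1)] by metis
  obtain s' t' where 2: "0 < s'" "s' < h" "0 < t'" "t' < h"
    "f (x + h *\<^sub>R b + h *\<^sub>R a) - f (x + h *\<^sub>R b) - f (x + h *\<^sub>R a) + f x
      = h * h * ?F b a (x + s' *\<^sub>R b + t' *\<^sub>R a)"
    using second_difference[OF sm h hr(2)] by metis
  have "x + h *\<^sub>R b + h *\<^sub>R a = x + h *\<^sub>R a + h *\<^sub>R b" by (simp add: algebra_simps)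
  with 2(5) have "f (x + h *\<^sub>R a + h *\<^sub>R b) - f (x + h *\<^sub>R a) - f (x + h *\<^sub>R b) + f x
      = h * h * ?F b a (x + s' *\<^sub>R b + t' *\<^sub>R a)"
    by (simp only: Groups.diff_right_commute[of _ "f (x + h *\<^sub>R b)"])
  with 1(5) have "h * h * ?F a b (x + s *\<^sub>R a + t *\<^sub>R b) = h * h * ?F b a (x + s' *\<^sub>R b + t' *\<^sub>R a)"
    by (rule trans[OF sym])
  then have "?F a b (x + s *\<^sub>R a + t *\<^sub>R b) = ?F b a (x + s' *\<^sub>R b + t' *\<^sub>R a)" using h by simp
  moreover have "dist (?F a b (x + s *\<^sub>R a + t *\<^sub>R b)) (?F a b x) < e"
    using near[OF 1(1-4) hr(1)] r by (intro d1(2)) simp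
  moreover have "dist (?F b a (x + s' *\<^sub>R b + t' *\<^sub>R a)) (?F b a x) < e"
    using near[OF 2(1-4) hr(2)] r by (intro d2(2)) simp
  moreover have False if "p = q" "\<bar>p - A\<bar> < \<bar>A - B\<bar> / 2" "\<bar>q - B\<bar> < \<bar>A - B\<bar> / 2" for p q A B :: real
    using that by (auto simp: abs_if split: if_splits)
  ultimately show False unfolding e_def dist_real_def by blast
qed

lemma symmetric_second_derivative:
  fixes f :: "'e::euclidean_space \<Rightarrow> 'f::euclidean_space"
  assumes "open S" "smooth_on S f" "x \<in> S"
  shows "frechet_derivative (\<lambda>y. frechet_derivative f (at y) a) (at x) b
       = frechet_derivative (\<lambda>y. frechet_derivative f (at y) b) (at x) a"
proof (rule euclidean_eqI)
  fix i :: 'f assume "i \<in> Basis"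
  have inner: "frechet_derivative (\<lambda>y. g y \<bullet> i) (at z) v = frechet_derivative g (at z) v \<bullet> i"
    if "smooth_on S g" "z \<in> S" for g :: "'e \<Rightarrow> 'f" and z v
    using frechet_derivativeI[OF has_derivative_inner_left[OF smooth_on_has_derivative[OF that]]] by simp
  have sm: "smooth_on S (\<lambda>y. f y \<bullet> i)"
    using assms by (intro smooth_on_linear_compose[OF bounded_linear_inner_left])
  have "frechet_derivative (\<lambda>y. frechet_derivative f (at y) v) (at x) w \<bullet> i
      = frechet_derivative (\<lambda>y. frechet_derivative (\<lambda>y. f y \<bullet> i) (at y) v) (at x) w" for v w
  proof -
    have "frechet_derivative (\<lambda>y. frechet_derivative (\<lambda>y. f y \<bullet> i) (at y) v) (at x)
       = frechet_derivative (\<lambda>y. frechet_derivative f (at y) v \<bullet> i) (at x)"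
      by (rule frechet_derivative_local[OF assms(1,3)]) (rule inner[OF assms(2)])
    then show ?thesis using inner[OF smooth_on_partial[OF assms(2)] assms(3)] by simp
  qed
  then show "frechet_derivative (\<lambda>y. frechet_derivative f (at y) a) (at x) b \<bullet> i
       = frechet_derivative (\<lambda>y. frechet_derivative f (at y) b) (at x) a \<bullet> i"
    using symmetric_second_derivative_real[OF assms(1) sm assms(3)] by simp
qed

section \<open>Tangent vectors and vector fields in charts\<close>

abbreviation transition :: "('a, 'e) chart \<Rightarrow> ('a, 'e) chart \<Rightarrow> 'e \<Rightarrow> 'e" where
  "transition c d \<equiv> snd d \<circ> chart_inv c"

text \<open>The local part of the notion of a manifold, which passes from a manifold to its slit tangent
  bundle by a computation in charts.\<close>

locale smooth_atlas =
  fixes A :: "('a, 'e::euclidean_space) chart set"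
  assumes chart_inj: "c \<in> A \<Longrightarrow> inj_on (snd c) (fst c)"
    and chart_open: "c \<in> A \<Longrightarrow> open (snd c ` fst c)"
    and overlap_open: "c \<in> A \<Longrightarrow> d \<in> A \<Longrightarrow> open (snd c ` (fst c \<inter> fst d))"
    and transition_smooth: "c \<in> A \<Longrightarrow> d \<in> A \<Longrightarrow>
      smooth_on (snd c ` (fst c \<inter> fst d)) (transition c d)"
begin

lemma chart_inv_chart [simp]: "c \<in> A \<Longrightarrow> p \<in> fst c \<Longrightarrow> chart_inv c (snd c p) = p"
  by (simp add: chart_inv_def chart_inj)

lemma transition_derivative_compose:
  assumes "c \<in> A" "d \<in> A" "e \<in> A" "p \<in> fst c" "p \<in> fst d" "p \<in> fst e"
  shows "frechet_derivative (transition c e) (at (snd c p)) v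
    = frechet_derivative (transition d e) (at (snd d p))
        (frechet_derivative (transition c d) (at (snd c p)) v)"
proof -
  let ?S = "snd c ` (fst c \<inter> fst d) \<inter> snd c ` (fst c \<inter> fst e)"
  have S: "open ?S" "snd c p \<in> ?S" using assms by (auto intro: overlap_open)
  have 1: "(transition c d has_derivative frechet_derivative (transition c d) (at (snd c p))) (at (snd c p))"
    by (rule smooth_on_has_derivative[OF transition_smooth]) (use assms in auto)
  have 2: "(transition d e has_derivative frechet_derivative (transition d e) (at (snd d p))) (at (transition c d (snd c p)))"
    using smooth_on_has_derivative[OF transition_smooth, of d e "snd d p"] assms by auto
  have "((\<lambda>x. transition d e (transition c d x)) has_derivative
     (\<lambda>v. frechet_derivative (transition d e) (at (snd d p))
        (frechet_derivative (transition c d) (at (snd c p)) v))) (at (snd c p))"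
    by (rule has_derivative_compose[OF 1 2])
  then have "(transition c e has_derivative
     (\<lambda>v. frechet_derivative (transition d e) (at (snd d p))
        (frechet_derivative (transition c d) (at (snd c p)) v))) (at (snd c p))"
  proof (rule has_derivative_transform_within_open[OF _ S])
    fix x assume "x \<in> ?S"
    then obtain q where q: "x = snd c q" "q \<in> fst c" "q \<in> fst d" by auto
    then show "transition d e (transition c d x) = transition c e x"
      using assms(1,2) by simp
  qed
  then show ?thesis by (simp add: frechet_derivativeI)
qed

lemma transition_derivative_same:
  assumes "c \<in> A" "p \<in> fst c"
  shows "frechet_derivative (transition c c) (at (snd c p)) v = v"
proof -
  have "frechet_derivative (transition c c) (at (snd c p)) = frechet_derivative (\<lambda>x. x) (at (snd c p))"
    by (rule frechet_derivative_local[OF chart_open[OF assms(1)]]) (use assms in auto)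
  then show ?thesis by simp
qed

lemma transition_derivative_linear:
  assumes "c \<in> A" "d \<in> A" "p \<in> fst c" "p \<in> fst d"
  shows "linear (frechet_derivative (transition c d) (at (snd c p)))"
  by (rule smooth_on_linear_derivative[OF transition_smooth[OF assms(1,2)]]) (use assms in auto)

lemma tangent_space_transition:
  assumes "v \<in> tangent_space A p" "c \<in> A" "d \<in> A" "p \<in> fst c" "p \<in> fst d"
  shows "v d = frechet_derivative (transition c d) (at (snd c p)) (v c)"
  using assms unfolding tangent_space_def mem_Collect_eq by blast

lemma tangent_space_outside:
  "v \<in> tangent_space A p \<Longrightarrow> \<not> (c \<in> A \<and> p \<in> fst c) \<Longrightarrow> v c = 0"
  unfolding tangent_space_def by blast

lemma tangent_space_eqI:
  assumes "v \<in> tangent_space A p" "w \<in> tangent_space A p" "c \<in> A" "p \<in> fst c" "v c = w c"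
  shows "v = w"
proof
  fix d
  show "v d = w d"
  proof (cases "d \<in> A \<and> p \<in> fst d")
    case True
    then have d: "d \<in> A" "p \<in> fst d" by auto
    show ?thesis
      using tangent_space_transition[OF assms(1,3) d(1) assms(4) d(2)]
        tangent_space_transition[OF assms(2,3) d(1) assms(4) d(2)] assms(5) by metis
  next
    case False
    then show ?thesis using assms(1,2) by (simp add: tangent_space_outside)
  qed
qed

text \<open>It suffices to check the transformation law from one chart to all others.\<close>

lemma tangent_spaceI:
  assumes "c \<in> A" "p \<in> fst c"
    and "\<And>d. d \<in> A \<Longrightarrow> p \<in> fst d \<Longrightarrow> v d = frechet_derivative (transition c d) (at (snd c p)) (v c)"
    and "\<And>d. \<not> (d \<in> A \<and> p \<in> fst d) \<Longrightarrow> v d = 0"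
  shows "v \<in> tangent_space A p"
  unfolding tangent_space_def mem_Collect_eq
proof (intro conjI ballI allI impI)
  fix d e assume *: "d \<in> A" "e \<in> A" "p \<in> fst d \<and> p \<in> fst e"
  then show "v e = frechet_derivative (transition d e) (at (snd d p)) (v d)"
    using assms(3)[of d] assms(3)[of e] transition_derivative_compose[OF assms(1) *(1,2) assms(2)]
    by metis
qed (rule assms(4))

lemma zero_tangent_space: "0 \<in> tangent_space A p"
  using transition_derivative_linear by (auto simp: tangent_space_def linear_0)

lemma combination_tangent_space:
  assumes v: "v \<in> tangent_space A p" and w: "w \<in> tangent_space A p"
  shows "a *\<^sub>R v + b *\<^sub>R w \<in> tangent_space A p"
  unfolding tangent_space_def mem_Collect_eq
proof (intro conjI ballI allI impI)
  fix c d assume *: "c \<in> A" "d \<in> A" "p \<in> fst c \<and> p \<in> fst d"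
  then have l: "linear (frechet_derivative (transition c d) (at (snd c p)))"
    by (intro transition_derivative_linear) auto
  show "(a *\<^sub>R v + b *\<^sub>R w) d
      = frechet_derivative (transition c d) (at (snd c p)) ((a *\<^sub>R v + b *\<^sub>R w) c)"
    unfolding plus_fun_def scaleR_fun_def linear_add[OF l] linear_scale[OF l]
    using tangent_space_transition[OF v, of c d] tangent_space_transition[OF w, of c d] * by metis
qed (use tangent_space_outside[OF v] tangent_space_outside[OF w] in \<open>simp add: scaleR_fun_def\<close>)

lemma scaleR_tangent_space: "v \<in> tangent_space A p \<Longrightarrow> a *\<^sub>R v \<in> tangent_space A p"
  using combination_tangent_space[of v p v a 0] by simp

lemma diff_tangent_space:
  "v \<in> tangent_space A p \<Longrightarrow> w \<in> tangent_space A p \<Longrightarrow> v - w \<in> tangent_space A p"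
  using combination_tangent_space[of v p w 1 "-1"] by simp

text \<open>The tangent vector at \<open>p\<close> with components \<open>v\<close> in the chart \<open>c\<close>.\<close>

definition tangent_of :: "'a \<Rightarrow> ('a, 'e) chart \<Rightarrow> 'e \<Rightarrow> ('a, 'e) tvec" where
  "tangent_of p c v = (\<lambda>d. if d \<in> A \<and> p \<in> fst d
     then frechet_derivative (transition c d) (at (snd c p)) v else 0)"

lemma tangent_of_same [simp]: "c \<in> A \<Longrightarrow> p \<in> fst c \<Longrightarrow> tangent_of p c v c = v"
  by (simp add: tangent_of_def transition_derivative_same)

lemma tangent_of_in: "c \<in> A \<Longrightarrow> p \<in> fst c \<Longrightarrow> tangent_of p c v \<in> tangent_space A p"
  by (rule tangent_spaceI[of c])
    (auto simp: tangent_of_def transition_derivative_same simp del: comp_apply)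

lemma tangent_of_component:
  "v \<in> tangent_space A p \<Longrightarrow> c \<in> A \<Longrightarrow> p \<in> fst c \<Longrightarrow> tangent_of p c (v c) = v"
  by (rule tangent_space_eqI[of _ p _ c]) (auto intro: tangent_of_in)

lemma openin_iff: "openin (atlas_topology A) U \<longleftrightarrow>
    U \<subseteq> carrier_of A \<and> (\<forall>c\<in>A. open (snd c ` (U \<inter> fst c)))"
  by (rule openin_atlas_topology[OF chart_inj])

lemma openin_chart: "c \<in> A \<Longrightarrow> openin (atlas_topology A) (fst c)"
  by (auto simp: openin_iff carrier_of_def Int_commute intro: overlap_open)

lemma openin_carrier: "openin (atlas_topology A) (carrier_of A)"
proof -
  have "carrier_of A \<inter> fst c = fst c" if "c \<in> A" for c using that by (auto simp: carrier_of_def)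
  then show ?thesis by (simp add: openin_iff chart_open)
qed

lemma openin_open: "openin (atlas_topology A) U \<Longrightarrow> c \<in> A \<Longrightarrow> open (snd c ` (U \<inter> fst c))"
  by (auto simp: openin_iff)

lemma chart_at: "p \<in> carrier_of A \<Longrightarrow> chart_at A p \<in> A \<and> p \<in> fst (chart_at A p)"
  unfolding chart_at_def by (rule someI_ex) (auto simp: carrier_of_def)

text \<open>On a domain inside one chart, smoothness in that chart suffices, since the coordinate changes
  are smooth.\<close>

lemma smooth_fun_chartI:
  assumes "openin (atlas_topology A) U" "c \<in> A" "U \<subseteq> fst c" "smooth_on (snd c ` U) (f \<circ> chart_inv c)"
  shows "smooth_fun A U f"
  unfolding smooth_fun_def
proof
  fix e assume e: "e \<in> A"
  have o: "open (snd e ` (U \<inter> fst e))" "open (snd c ` U)"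
    using openin_open[OF assms(1) e] openin_open[OF assms(1,2)] assms(3) by (auto simp: Int_absorb2)
  have "snd e ` (U \<inter> fst e) \<subseteq> snd e ` (fst e \<inter> fst c)" using assms(3) by auto
  then have sm: "smooth_on (snd e ` (U \<inter> fst e)) (transition e c)"
    by (rule smooth_on_subset[OF transition_smooth[OF e assms(2)]])
  show "smooth_on (snd e ` (U \<inter> fst e)) (f \<circ> chart_inv e)"
  proof (rule smooth_on_cong[OF o(1)])
    show "smooth_on (snd e ` (U \<inter> fst e)) (\<lambda>x. (f \<circ> chart_inv c) (transition e c x))"
      by (rule smooth_on_compose[OF o _ sm assms(4)]) (use e in auto)
  next
    fix x assume "x \<in> snd e ` (U \<inter> fst e)"
    then obtain p where "x = snd e p" "p \<in> U" "p \<in> fst e" by auto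
    then show "(f \<circ> chart_inv c) (transition e c x) = (f \<circ> chart_inv e) x"
      using e assms(2,3) by (auto simp: subset_iff)
  qed
qed

lemma smooth_fun_subset_chart:
  assumes "smooth_fun A U f" "c \<in> A" "U \<subseteq> fst c"
  shows "smooth_on (snd c ` U) (f \<circ> chart_inv c)"
  using assms by (metis Int_absorb2 smooth_fun_def)

lemma vector_fields_iff:
  assumes "openin (atlas_topology A) U"
  shows "X \<in> vector_fields A U \<longleftrightarrow> (\<forall>p\<in>U. X p \<in> tangent_space A p) \<and>
    (\<forall>c\<in>A. smooth_on (snd c ` (U \<inter> fst c)) (\<lambda>x. X (chart_inv c x) c))"
proof -
  have "smooth_fun A (U \<inter> fst c) (\<lambda>p. X p c) \<longleftrightarrow> smooth_on (snd c ` (U \<inter> fst c)) (\<lambda>x. X (chart_inv c x) c)"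
    if "c \<in> A" for c
    using smooth_fun_chartI[OF openin_Int[OF assms openin_chart[OF that]] that, of "\<lambda>p. X p c"]
      smooth_fun_subset_chart[OF _ that, of "U \<inter> fst c" "\<lambda>p. X p c"] 
    by (auto simp: comp_def)
  then show ?thesis by (auto simp: vector_fields_def)
qed

text \<open>Constant-coefficient fields of a chart; they probe the coefficients of a connection.\<close>

lemma coordinate_field:
  assumes "c \<in> A"
  shows "(\<lambda>p. tangent_of p c v) \<in> vector_fields A (fst c)"
  unfolding vector_fields_iff[OF openin_chart[OF assms]]
proof (intro conjI ballI)
  show "tangent_of p c v \<in> tangent_space A p" if "p \<in> fst c" for p
    using assms that by (rule tangent_of_in)
next
  fix d assume d: "d \<in> A"
  have o: "open (snd d ` (fst c \<inter> fst d))" "open (snd c ` (fst c \<inter> fst d))"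
    using overlap_open[OF d assms] overlap_open[OF assms d] by (auto simp: Int_commute)
  show "smooth_on (snd d ` (fst c \<inter> fst d)) (\<lambda>x. tangent_of (chart_inv d x) c v d)"
  proof (rule smooth_on_cong[OF o(1)])
    show "smooth_on (snd d ` (fst c \<inter> fst d)) (\<lambda>x. frechet_derivative (transition c d) (at (transition d c x)) v)"
    proof (rule smooth_on_compose[OF o, where f = "transition d c"])
      show "smooth_on (snd d ` (fst c \<inter> fst d)) (transition d c)"
        using transition_smooth[OF d assms] by (simp add: Int_commute)
      show "smooth_on (snd c ` (fst c \<inter> fst d)) (\<lambda>x. frechet_derivative (transition c d) (at x) v)"
        by (rule smooth_on_partial[OF transition_smooth[OF assms d]])
    qed (use d in auto)
  qed (use d in \<open>auto simp: tangent_of_def\<close>)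
qed

lemma lie_bracket_cong:
  assumes U: "openin (atlas_topology A) U" "p \<in> U"
    and X: "\<And>q. q \<in> U \<Longrightarrow> X q = X' q" and Y: "\<And>q. q \<in> U \<Longrightarrow> Y q = Y' q"
  shows "lie_bracket A X Y p = lie_bracket A X' Y' p"
proof
  fix c
  show "lie_bracket A X Y p c = lie_bracket A X' Y' p c"
  proof (cases "c \<in> A \<and> p \<in> fst c")
    case True
    then have c: "c \<in> A" "p \<in> fst c" by auto
    have x: "snd c p \<in> snd c ` (U \<inter> fst c)" using c U(2) by auto
    have "frechet_derivative (\<lambda>x. X (chart_inv c x) c) (at (snd c p)) = frechet_derivative (\<lambda>x. X' (chart_inv c x) c) (at (snd c p))"
      "frechet_derivative (\<lambda>x. Y (chart_inv c x) c) (at (snd c p)) = frechet_derivative (\<lambda>x. Y' (chart_inv c x) c) (at (snd c p))"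
      by (rule frechet_derivative_local[OF openin_open[OF U(1) c(1)] x]; use c X Y in auto)+
    then show ?thesis using X Y U(2) by (simp add: lie_bracket_def)
  qed (auto simp: lie_bracket_def)
qed

text \<open>The second derivatives of a coordinate change enter the transformation of both terms of the
  bracket; they cancel because they are symmetric.\<close>

lemma lie_bracket_tangent:
  assumes U: "openin (atlas_topology A) U" and "X \<in> vector_fields A U" "Y \<in> vector_fields A U" "p \<in> U"
  shows "lie_bracket A X Y p \<in> tangent_space A p"
proof -
  obtain c where c: "c \<in> A" "p \<in> fst c"
    using U assms(4) by (auto simp: openin_iff carrier_of_def)
  let ?x = "snd c p"
  show ?thesis
  proof (rule tangent_spaceI[OF c])
    fix d assume d: "d \<in> A" "p \<in> fst d"
    \<comment> \<open>The components of a field \<open>Z\<close> satisfy \<open>Z\<^sub>d(\<tau> x) = \<tau>'(x) (Z\<^sub>c x)\<close>; the fact \<open>key\<close> below is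
      the derivative of this relation.\<close>
    let ?\<tau> = "transition c d" and ?W = "U \<inter> fst c \<inter> fst d"
    let ?C = "\<lambda>Z x. Z (chart_inv c x) c" and ?D = "\<lambda>Z x. Z (chart_inv d x) d"
    let ?S = "snd c ` (fst c \<inter> fst d)"
    have S: "open ?S" "?x \<in> ?S" using c d by (auto intro: overlap_open)
    have SU: "open (snd c ` ?W)" "?x \<in> snd c ` ?W"
    proof -
      have "snd c ` ?W = snd c ` (U \<inter> fst c) \<inter> ?S" 
        using inj_onD[OF chart_inj[OF c(1)]] by auto
      then show "open (snd c ` ?W)" using openin_open[OF U c(1)] S by auto
      show "?x \<in> snd c ` ?W" using c d assms(4) by auto
    qed
    have smC: "smooth_on (snd c ` (U \<inter> fst c)) (?C Z)" "smooth_on (snd d ` (U \<inter> fst d)) (?D Z)"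
      if "Z \<in> vector_fields A U" for Z
      using that c d by (auto simp: vector_fields_iff[OF U])
    have dC: "(?C Z has_derivative frechet_derivative (?C Z) (at ?x)) (at ?x)"
      and dD: "(?D Z has_derivative frechet_derivative (?D Z) (at (snd d p))) (at (?\<tau> ?x))"
      if "Z \<in> vector_fields A U" for Z
      using smooth_on_has_derivative[OF smC(1)[OF that], of ?x] smooth_on_has_derivative[OF smC(2)[OF that], of "snd d p"]
        c d assms(4) by auto
    have d\<tau>: "(?\<tau> has_derivative frechet_derivative ?\<tau> (at ?x)) (at ?x)"
      by (rule smooth_on_has_derivative[OF transition_smooth[OF c(1) d(1)] S(2)])
    have key: "frechet_derivative (?D Z) (at (snd d p)) (frechet_derivative ?\<tau> (at ?x) v)
       = frechet_derivative (\<lambda>y. frechet_derivative ?\<tau> (at y) (Z p c)) (at ?x) v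
         + frechet_derivative ?\<tau> (at ?x) (frechet_derivative (?C Z) (at ?x) v)"
      if Z: "Z \<in> vector_fields A U" for Z v
    proof -
      have 1: "((\<lambda>x. ?D Z (?\<tau> x)) has_derivative
          (\<lambda>v. frechet_derivative (?D Z) (at (snd d p)) (frechet_derivative ?\<tau> (at ?x) v))) (at ?x)"
        by (rule has_derivative_compose[OF d\<tau> dD[OF Z]])
      have 2: "((\<lambda>x. frechet_derivative ?\<tau> (at x) (?C Z x)) has_derivative
         (\<lambda>h. frechet_derivative (\<lambda>y. frechet_derivative ?\<tau> (at y) (?C Z ?x)) (at ?x) h
         + frechet_derivative ?\<tau> (at ?x) (frechet_derivative (?C Z) (at ?x) h))) (at ?x)"
        by (rule has_derivative_derivative_along[OF S(1) transition_smooth[OF c(1) d(1)] S(2) dC[OF Z]])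
      have eq: "frechet_derivative ?\<tau> (at x) (?C Z x) = ?D Z (?\<tau> x)" if x: "x \<in> snd c ` ?W" for x
      proof -
        obtain q where q: "x = snd c q" "q \<in> U" "q \<in> fst c" "q \<in> fst d" using x by auto
        have "Z q \<in> tangent_space A q" using Z q by (auto simp: vector_fields_iff[OF U])
        from tangent_space_transition[OF this c(1) d(1) q(3,4)] show ?thesis using q c d by simp
      qed
      have "((\<lambda>x. ?D Z (?\<tau> x)) has_derivative
         (\<lambda>h. frechet_derivative (\<lambda>y. frechet_derivative ?\<tau> (at y) (?C Z ?x)) (at ?x) h
         + frechet_derivative ?\<tau> (at ?x) (frechet_derivative (?C Z) (at ?x) h))) (at ?x)"
        by (rule has_derivative_transform_within_open[OF 2 SU]) (rule eq)
      from fun_cong[OF has_derivative_unique[OF 1 this], of v] c show ?thesis by simp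
    qed
    have tr: "Z p d = frechet_derivative ?\<tau> (at ?x) (Z p c)" if "Z \<in> vector_fields A U" for Z
      using that assms(4) by (intro tangent_space_transition c d) (auto simp: vector_fields_iff[OF U])
    have sym: "frechet_derivative (\<lambda>y. frechet_derivative ?\<tau> (at y) (X p c)) (at ?x) (Y p c)
        = frechet_derivative (\<lambda>y. frechet_derivative ?\<tau> (at y) (Y p c)) (at ?x) (X p c)"
      by (rule symmetric_second_derivative[OF S(1) transition_smooth[OF c(1) d(1)] S(2)])
    have "lie_bracket A X Y p d
        = frechet_derivative (?D Y) (at (snd d p)) (frechet_derivative ?\<tau> (at ?x) (X p c))
        - frechet_derivative (?D X) (at (snd d p)) (frechet_derivative ?\<tau> (at ?x) (Y p c))"
      using d tr[OF assms(2)] tr[OF assms(3)] by (simp add: lie_bracket_def)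
    also have "\<dots> = frechet_derivative ?\<tau> (at ?x) (frechet_derivative (?C Y) (at ?x) (X p c))
        - frechet_derivative ?\<tau> (at ?x) (frechet_derivative (?C X) (at ?x) (Y p c))"
      unfolding key[OF assms(2)] key[OF assms(3)] sym by simp
    also have "\<dots> = frechet_derivative ?\<tau> (at ?x) (lie_bracket A X Y p c)"
      using c by (simp add: lie_bracket_def linear_diff[OF has_derivative_linear[OF d\<tau>]] del: comp_apply)
    finally show "lie_bracket A X Y p d = frechet_derivative ?\<tau> (at ?x) (lie_bracket A X Y p c)" .
  qed (auto simp: lie_bracket_def)
qed

lemma lie_bracket_vector_field:
  assumes U: "openin (atlas_topology A) U" and "X \<in> vector_fields A U" "Y \<in> vector_fields A U"
  shows "lie_bracket A X Y \<in> vector_fields A U"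
  unfolding vector_fields_iff[OF U]
proof (intro conjI ballI)
  show "lie_bracket A X Y p \<in> tangent_space A p" if "p \<in> U" for p
    using assms that by (rule lie_bracket_tangent)
next
  fix c assume c: "c \<in> A"
  let ?C = "\<lambda>Z x. Z (chart_inv c x) c" and ?S = "snd c ` (U \<inter> fst c)"
  have o: "open ?S" using U c by (rule openin_open)
  have sm: "smooth_on ?S (?C Z)" if "Z \<in> vector_fields A U" for Z
    using that c by (simp add: vector_fields_iff[OF U])
  show "smooth_on ?S (\<lambda>x. lie_bracket A X Y (chart_inv c x) c)"
  proof (rule smooth_on_cong[OF o])
    show "smooth_on ?S (\<lambda>x. frechet_derivative (?C Y) (at x) (?C X x) - frechet_derivative (?C X) (at x) (?C Y x))"
      using assms by (intro smooth_on_diff smooth_on_derivative_along sm o)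
  qed (use c in \<open>auto simp: lie_bracket_def\<close>)
qed

end

lemma smooth_manifold_atlas: "smooth_manifold M \<Longrightarrow> smooth_atlas M"
  by (simp add: smooth_manifold_def smooth_atlas_def)

section \<open>The slit tangent bundle\<close>

locale base_atlas = smooth_atlas M for M :: "('a, 'e::euclidean_space) chart set"
begin

abbreviation sc :: "('a, 'e) chart \<Rightarrow> (('a, 'e) tpoint, 'e \<times> 'e) chart" where
  "sc \<equiv> slit_chart M"

abbreviation dtrans :: "('a, 'e) chart \<Rightarrow> ('a, 'e) chart \<Rightarrow> 'e \<Rightarrow> 'e \<Rightarrow> 'e" where
  "dtrans c d x \<equiv> frechet_derivative (transition c d) (at x)"

lemma fst_sc: "u \<in> fst (sc c) \<longleftrightarrow> u \<in> slit_bundle M \<and> fst u \<in> fst c"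
  by (simp add: slit_chart_def)

lemma snd_sc: "snd (sc c) u = (snd c (fst u), snd u c)"
  by (simp add: slit_chart_def)

lemma slit_bundle_tangent: "u \<in> slit_bundle M \<Longrightarrow> snd u \<in> tangent_space M (fst u)"
  by (auto simp: slit_bundle_def)

lemma slit_nonzero:
  assumes "c \<in> M" "u \<in> fst (sc c)"
  shows "snd u c \<noteq> 0"
proof
  assume "snd u c = 0"
  then have "snd u = 0"
    using assms tangent_space_eqI[OF slit_bundle_tangent zero_tangent_space, of u c]
    by (auto simp: fst_sc)
  then show False using assms by (auto simp: fst_sc slit_bundle_def)
qed

text \<open>The inverse of the induced chart.\<close>

definition point_of :: "('a, 'e) chart \<Rightarrow> 'e \<times> 'e \<Rightarrow> ('a, 'e) tpoint" where
  "point_of c z = (chart_inv c (fst z), tangent_of (chart_inv c (fst z)) c (snd z))"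

lemma point_of:
  assumes "c \<in> M" "z \<in> snd c ` fst c \<times> (- {0})"
  shows "point_of c z \<in> fst (sc c)" "snd (sc c) (point_of c z) = z"
proof -
  obtain p y where z: "z = (snd c p, y)" "p \<in> fst c" "y \<noteq> 0" using assms(2) by auto
  have t: "tangent_of p c y \<in> tangent_space M p" "tangent_of p c y c = y"
    using assms(1) z(2) by (auto intro: tangent_of_in)
  have "tangent_of p c y \<noteq> 0" using t(2) z(3) by (metis zero_fun_apply)
  then show "point_of c z \<in> fst (sc c)"
    using assms(1) z t by (auto simp: fst_sc point_of_def slit_bundle_def carrier_of_def)
  show "snd (sc c) (point_of c z) = z" using assms(1) z by (simp add: point_of_def snd_sc)
qed

lemma sc_inj:
  assumes "c \<in> M" shows "inj_on (snd (sc c)) (fst (sc c))"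
proof (rule inj_onI)
  fix u w assume uw: "u \<in> fst (sc c)" "w \<in> fst (sc c)" "snd (sc c) u = snd (sc c) w"
  then have "fst u = fst w"
    using inj_onD[OF chart_inj[OF assms]] by (auto simp: fst_sc snd_sc)
  moreover have "snd u = snd w"
    using uw calculation assms slit_bundle_tangent[of u] slit_bundle_tangent[of w]
    by (intro tangent_space_eqI[of _ "fst u" _ c]) (auto simp: fst_sc snd_sc)
  ultimately show "u = w" by (rule prod_eqI)
qed

lemma sc_inv: "c \<in> M \<Longrightarrow> u \<in> fst (sc c) \<Longrightarrow> chart_inv (sc c) (snd (sc c) u) = u"
  by (simp add: chart_inv_def sc_inj)

lemma sc_inv_eq:
  "c \<in> M \<Longrightarrow> z \<in> snd c ` fst c \<times> (- {0}) \<Longrightarrow> chart_inv (sc c) z = point_of c z"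
  using point_of[of c z] sc_inv[of c "point_of c z"] by simp

lemma sc_overlap:
  assumes "c \<in> M" "d \<in> M"
  shows "snd (sc c) ` (fst (sc c) \<inter> fst (sc d)) = snd c ` (fst c \<inter> fst d) \<times> (- {0})"
proof (intro equalityI subsetI)
  fix z assume "z \<in> snd (sc c) ` (fst (sc c) \<inter> fst (sc d))"
  then obtain u where u: "z = snd (sc c) u" "u \<in> fst (sc c)" "u \<in> fst (sc d)" by auto
  then show "z \<in> snd c ` (fst c \<inter> fst d) \<times> (- {0})"
    using slit_nonzero[OF assms(1) u(2)] by (auto simp: fst_sc snd_sc)
next
  fix z assume "z \<in> snd c ` (fst c \<inter> fst d) \<times> (- {0 :: 'e})"
  then obtain p y where z: "z = (snd c p, y)" "p \<in> fst c" "p \<in> fst d" "y \<noteq> 0" by auto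
  then have "z \<in> snd c ` fst c \<times> (- {0})" by auto
  from point_of[OF assms(1) this] z assms show "z \<in> snd (sc c) ` (fst (sc c) \<inter> fst (sc d))"
    by (intro image_eqI[of _ _ "point_of c z"]) (auto simp: fst_sc point_of_def)
qed

lemma sc_transition:
  assumes "c \<in> M" "d \<in> M" "z \<in> snd c ` (fst c \<inter> fst d) \<times> (- {0})"
  shows "transition (sc c) (sc d) z = (transition c d (fst z), dtrans c d (fst z) (snd z))"
proof -
  obtain p y where z: "z = (snd c p, y)" "p \<in> fst c" "p \<in> fst d" "y \<noteq> 0" using assms(3) by auto
  then have "chart_inv (sc c) z = point_of c z" using assms by (intro sc_inv_eq) auto
  then show ?thesis using z assms by (simp add: snd_sc point_of_def tangent_of_def)
qed

lemma open_overlap_slit: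
  "c \<in> M \<Longrightarrow> d \<in> M \<Longrightarrow> open (snd c ` (fst c \<inter> fst d) \<times> (- {0 :: 'e}))"
  by (intro open_Times overlap_open) auto

lemma smooth_on_vertical_linear:
  assumes "open S" "open T" "fst ` T \<subseteq> S" "smooth_on S f"
  shows "smooth_on (T :: ('e \<times> 'e) set) (\<lambda>z. frechet_derivative f (at (fst z)) (snd z))"
proof (rule smooth_on_cong[OF assms(2)])
  show "smooth_on T (\<lambda>z. \<Sum>b\<in>Basis. (snd z \<bullet> b) *\<^sub>R frechet_derivative f (at (fst z)) b)"
    by (intro smooth_on_sum smooth_on_bilinear[OF bounded_bilinear_scaleR] assms
        smooth_on_linear bounded_linear_intros bounded_linear_inner_left_comp bounded_linear_snd
        smooth_on_compose[OF assms(2,1,3) smooth_on_linear[OF bounded_linear_fst] smooth_on_partial[OF assms(4)]])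
next
  fix z assume "z \<in> T"
  then have "fst z \<in> S" using assms(3) by auto
  then show "(\<Sum>b\<in>Basis. (snd z \<bullet> b) *\<^sub>R frechet_derivative f (at (fst z)) b)
      = frechet_derivative f (at (fst z)) (snd z)"
    by (rule derivative_basis_expansion[OF assms(4), symmetric])
qed

text \<open>The change of induced coordinates is \<open>(x, y) \<mapsto> (\<tau> x, \<tau>'(x) y)\<close>, which is smooth because
  \<open>\<tau>\<close> is and which is defined on the open set of all \<open>(x, y)\<close> with \<open>x\<close> in the overlap and
  \<open>y \<noteq> 0\<close>.\<close>

lemma slit_atlas_smooth: "smooth_atlas (slit_atlas M)"
proof
  fix c' assume "c' \<in> slit_atlas M"
  then obtain c where c: "c \<in> M" "c' = sc c" by (auto simp: slit_atlas_def)
  then show "inj_on (snd c') (fst c')" by (simp add: sc_inj)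
  show "open (snd c' ` fst c')"
    using sc_overlap[OF c(1) c(1)] open_overlap_slit[OF c(1) c(1)] c(2) by simp
  fix d' assume "d' \<in> slit_atlas M"
  then obtain d where d: "d \<in> M" "d' = sc d" by (auto simp: slit_atlas_def)
  show "open (snd c' ` (fst c' \<inter> fst d'))"
    using sc_overlap[OF c(1) d(1)] open_overlap_slit[OF c(1) d(1)] c(2) d(2) by simp
  let ?S = "snd c ` (fst c \<inter> fst d)"
  let ?T = "?S \<times> (- {0 :: 'e})"
  have o: "open ?S" "open ?T" using c d by (auto intro: overlap_open open_overlap_slit)
  have "smooth_on ?T (\<lambda>z. (transition c d (fst z), dtrans c d (fst z) (snd z)))"
    using c d o
    by (intro smooth_on_Pair smooth_on_vertical_linear[of ?S]
        smooth_on_compose[OF o(2) o(1) _ smooth_on_linear[OF bounded_linear_fst]] transition_smooth) auto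
  then have "smooth_on ?T (transition (sc c) (sc d))"
    by (rule smooth_on_cong[OF o(2), rotated]) (rule sc_transition[OF c(1) d(1), symmetric])
  then show "smooth_on (snd c' ` (fst c' \<inter> fst d')) (transition c' d')"
    using sc_overlap[OF c(1) d(1)] c(2) d(2) by simp
qed

sublocale slit: smooth_atlas "slit_atlas M"
  by (rule slit_atlas_smooth)

abbreviation "ST \<equiv> tangent_space (slit_atlas M)"

lemma sc_in: "c \<in> M \<Longrightarrow> sc c \<in> slit_atlas M"
  by (simp add: slit_atlas_def)

lemma slit_carrier: "carrier_of (slit_atlas M) = slit_bundle M"
  by (auto simp: carrier_of_def slit_atlas_def fst_sc) (auto simp: slit_bundle_def carrier_of_def)

lemma slit_bundle_chart:
  assumes "u \<in> slit_bundle M" obtains c where "c \<in> M" "u \<in> fst (sc c)"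
  using assms by (metis (no_types, lifting) UN_E carrier_of_def image_iff slit_atlas_def slit_carrier)

lemma slit_chart_at:
  assumes "u \<in> slit_bundle M"
  obtains c where "c \<in> M" "u \<in> fst (sc c)" "chart_at (slit_atlas M) u = sc c"
proof -
  have "chart_at (slit_atlas M) u \<in> slit_atlas M" "u \<in> fst (chart_at (slit_atlas M) u)"
    using slit.chart_at[of u] assms by (auto simp: slit_carrier)
  then show ?thesis using that unfolding slit_atlas_def by auto
qed

lemma openin_slit_bundle: "openin (atlas_topology (slit_atlas M)) (slit_bundle M)"
  using slit.openin_carrier by (simp add: slit_carrier)

lemma open_sc: "c \<in> M \<Longrightarrow> open (snd (sc c) ` fst (sc c))"
  by (rule slit.chart_open[OF sc_in])

text \<open>Base components of vectors tangent to the slit bundle transform like vectors on the base, and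
  so do the fibre components of vertical vectors. The first fact makes \<^const>\<open>rho\<close> the projection
  to base components, the second makes \<^const>\<open>vlift\<close> independent of the chart.\<close>

lemma sc_transition_derivative:
  assumes "c \<in> M" "d \<in> M" "u \<in> fst (sc c)" "u \<in> fst (sc d)"
  defines "D \<equiv> frechet_derivative (transition (sc c) (sc d)) (at (snd (sc c) u))"
  shows "fst (D h) = dtrans c d (snd c (fst u)) (fst h)"
    and "fst h = 0 \<Longrightarrow> snd (D h) = dtrans c d (snd c (fst u)) (snd h)"
proof -
  let ?S = "snd c ` (fst c \<inter> fst d)" and ?x = "snd c (fst u)" and ?z = "snd (sc c) u"
  let ?p = "\<lambda>b x. dtrans c d x b"
  have x: "?x \<in> ?S" using assms by (auto simp: fst_sc)
  have z: "?z \<in> ?S \<times> (- {0})" using sc_overlap[OF assms(1,2)] assms(3,4) by auto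
  have sm: "smooth_on ?S (transition c d)" using assms by (intro transition_smooth)
  have 1: "((\<lambda>z. transition c d (fst z)) has_derivative (\<lambda>h. dtrans c d ?x (fst h))) (at ?z)"
    by (rule has_derivative_compose[OF has_derivative_fst[OF has_derivative_ident]])
      (use smooth_on_has_derivative[OF sm x] in \<open>simp only: snd_sc fst_conv\<close>)
  have p: "((\<lambda>z. ?p b (fst z)) has_derivative (\<lambda>h. frechet_derivative (?p b) (at ?x) (fst h))) (at ?z)" for b
    by (rule has_derivative_compose[OF has_derivative_fst[OF has_derivative_ident]])
      (use smooth_on_has_derivative[OF smooth_on_partial[OF sm] x] in \<open>simp only: snd_sc fst_conv\<close>)
  have 2: "((\<lambda>z. \<Sum>b\<in>Basis. (snd z \<bullet> b) *\<^sub>R ?p b (fst z)) has_derivative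
     (\<lambda>h. \<Sum>b\<in>Basis. (snd ?z \<bullet> b) *\<^sub>R frechet_derivative (?p b) (at ?x) (fst h) + (snd h \<bullet> b) *\<^sub>R ?p b (fst ?z))) (at ?z)"
    by (intro has_derivative_sum has_derivative_scaleR p has_derivative_inner_left has_derivative_snd has_derivative_ident)
  let ?E = "\<lambda>h. (dtrans c d ?x (fst h), \<Sum>b\<in>Basis. (snd ?z \<bullet> b) *\<^sub>R frechet_derivative (?p b) (at ?x) (fst h) + (snd h \<bullet> b) *\<^sub>R ?p b (fst ?z))"
  have "(transition (sc c) (sc d) has_derivative ?E) (at ?z)"
  proof (rule has_derivative_transform_within_open[OF has_derivative_Pair[OF 1 2] _ z])
    show "open (?S \<times> (- {0 :: 'e}))" using assms by (intro open_overlap_slit)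
    show "(transition c d (fst z), \<Sum>b\<in>Basis. (snd z \<bullet> b) *\<^sub>R ?p b (fst z)) = transition (sc c) (sc d) z"
      if "z \<in> ?S \<times> (- {0})" for z
    proof -
      have "dtrans c d (fst z) (snd z) = (\<Sum>b\<in>Basis. (snd z \<bullet> b) *\<^sub>R ?p b (fst z))"
        using that by (intro derivative_basis_expansion[OF sm]) auto
      then show ?thesis using sc_transition[OF assms(1,2) that] by metis
    qed
  qed
  then have D: "D = ?E" unfolding D_def by (rule frechet_derivativeI)
  show "fst (D h) = dtrans c d ?x (fst h)" by (simp add: D)
  assume h: "fst h = 0"
  have "frechet_derivative (?p b) (at ?x) 0 = 0" for b
    by (rule linear_0[OF smooth_on_linear_derivative[OF smooth_on_partial[OF sm] x]])
  moreover have "dtrans c d ?x (snd h) = (\<Sum>b\<in>Basis. (snd h \<bullet> b) *\<^sub>R ?p b ?x)"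
    by (rule derivative_basis_expansion[OF sm x])
  ultimately show "snd (D h) = dtrans c d ?x (snd h)"
    unfolding D snd_conv h snd_sc fst_conv by simp
qed

lemma rho_component:
  assumes "\<xi> \<in> ST u" "c \<in> M" "u \<in> fst (sc c)"
  shows "rho M u \<xi> c = fst (\<xi> (sc c))"
proof -
  obtain d where d: "d \<in> M" "u \<in> fst (sc d)" "chart_at (slit_atlas M) u = sc d"
    using slit_chart_at assms(3) by (metis fst_sc)
  let ?t = "transition (sc d) (sc c)"
  have eq: "snd c \<circ> fst \<circ> chart_inv (sc d) = (\<lambda>z. fst (?t z))"
    by (auto simp: snd_sc)
  have x: "snd (sc d) u \<in> snd (sc d) ` (fst (sc d) \<inter> fst (sc c))" using assms d by auto
  have t: "(?t has_derivative frechet_derivative ?t (at (snd (sc d) u))) (at (snd (sc d) u))"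
    by (rule smooth_on_has_derivative[OF slit.transition_smooth[OF sc_in sc_in] x]) (use assms d in auto)
  have "rho M u \<xi> c = frechet_derivative (\<lambda>z. fst (?t z)) (at (snd (sc d) u)) (\<xi> (sc d))"
    using assms unfolding rho_def differential_def Let_def d(3) eq by (simp add: fst_sc)
  also have "\<dots> = fst (frechet_derivative ?t (at (snd (sc d) u)) (\<xi> (sc d)))"
    by (simp only: frechet_derivativeI[OF has_derivative_fst[OF t]])
  also have "\<dots> = fst (\<xi> (sc c))"
    using slit.tangent_space_transition[OF assms(1) sc_in[OF d(1)] sc_in[OF assms(2)] d(2) assms(3)] by metis
  finally show ?thesis .
qed

lemma rho_outside: "\<not> (c \<in> M \<and> fst u \<in> fst c) \<Longrightarrow> rho M u \<xi> c = 0"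
  unfolding rho_def differential_def Let_def by auto

lemma rho_tangent:
  assumes "\<xi> \<in> ST u" "u \<in> slit_bundle M"
  shows "rho M u \<xi> \<in> tangent_space M (fst u)"
proof -
  obtain c where c: "c \<in> M" "u \<in> fst (sc c)" using slit_bundle_chart assms(2) by blast
  show ?thesis
  proof (rule tangent_spaceI)
    fix d assume d: "d \<in> M" "fst u \<in> fst d"
    then have ud: "u \<in> fst (sc d)" using assms(2) by (simp add: fst_sc)
    have "fst (\<xi> (sc d)) = dtrans c d (snd c (fst u)) (fst (\<xi> (sc c)))"
      using slit.tangent_space_transition[OF assms(1) sc_in[OF c(1)] sc_in[OF d(1)] c(2) ud]
        sc_transition_derivative(1)[OF c(1) d(1) c(2) ud] by metis
    then show "rho M u \<xi> d = dtrans c d (snd c (fst u)) (rho M u \<xi> c)"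
      using rho_component[OF assms(1) c] rho_component[OF assms(1) d(1) ud] by metis
  qed (use c in \<open>auto simp: rho_outside fst_sc\<close>)
qed

lemma rho_linear:
  assumes "\<xi> \<in> ST u" "\<zeta> \<in> ST u" "u \<in> slit_bundle M"
  shows "rho M u (a *\<^sub>R \<xi> + b *\<^sub>R \<zeta>) = a *\<^sub>R rho M u \<xi> + b *\<^sub>R rho M u \<zeta>"
proof
  fix c
  show "rho M u (a *\<^sub>R \<xi> + b *\<^sub>R \<zeta>) c = (a *\<^sub>R rho M u \<xi> + b *\<^sub>R rho M u \<zeta>) c"
  proof (cases "c \<in> M \<and> fst u \<in> fst c")
    case True
    then have c: "c \<in> M" "u \<in> fst (sc c)" using assms(3) by (auto simp: fst_sc)
    show ?thesis
      using rho_component[OF slit.combination_tangent_space[OF assms(1,2)] c]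
        rho_component[OF assms(1) c] rho_component[OF assms(2) c]
      by (simp add: scaleR_fun_def)
  qed (simp add: rho_outside scaleR_fun_def)
qed

lemma vlift_component:
  assumes "u \<in> slit_bundle M" "c \<in> M" "fst u \<in> fst c"
  shows "vlift M u v (sc c) = (0, v c)"
proof -
  have "((\<lambda>t. (snd c (fst u), snd u c + t *\<^sub>R v c)) has_vector_derivative (0, v c)) (at 0)"
    by (auto intro!: derivative_eq_intros has_vector_derivative_Pair)
  moreover have "snd (sc c) \<circ> (\<lambda>t. (fst u, snd u + t *\<^sub>R v)) = (\<lambda>t. (snd c (fst u), snd u c + t *\<^sub>R v c))"
    by (auto simp: snd_sc scaleR_fun_def)
  ultimately show ?thesis
    using assms vector_derivative_at by (simp add: vlift_def velocity_def sc_in fst_sc)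
qed

lemma vlift_tangent:
  assumes "u \<in> slit_bundle M" "v \<in> tangent_space M (fst u)"
  shows "vlift M u v \<in> ST u"
proof -
  obtain c where c: "c \<in> M" "u \<in> fst (sc c)" using slit_bundle_chart assms(1) by blast
  show ?thesis
  proof (rule slit.tangent_spaceI[OF sc_in[OF c(1)] c(2)])
    fix d' assume d': "d' \<in> slit_atlas M" "u \<in> fst d'"
    then obtain d where d: "d \<in> M" "d' = sc d" by (auto simp: slit_atlas_def)
    have ud: "u \<in> fst (sc d)" using d d' by simp
    have "v d = dtrans c d (snd c (fst u)) (v c)"
      by (rule tangent_space_transition[OF assms(2) c(1) d(1)]) (use c ud in \<open>auto simp: fst_sc\<close>)
    moreover have "dtrans c d (snd c (fst u)) 0 = 0"
      by (rule linear_0[OF transition_derivative_linear]) (use c d ud in \<open>auto simp: fst_sc\<close>)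
    ultimately have "frechet_derivative (transition (sc c) (sc d)) (at (snd (sc c) u)) (0, v c) = (0, v d)"
      using sc_transition_derivative[OF c(1) d(1) c(2) ud, of "(0, v c)"] by (metis fst_conv snd_conv prod_eqI)
    moreover have "vlift M u v (sc d) = (0, v d)" "vlift M u v (sc c) = (0, v c)"
      using assms(1) c d ud by (auto simp: fst_sc vlift_component)
    ultimately show "vlift M u v d' = frechet_derivative (transition (sc c) d') (at (snd (sc c) u)) (vlift M u v (sc c))"
      unfolding d(2) by metis
  next
    fix d' assume "\<not> (d' \<in> slit_atlas M \<and> u \<in> fst d')"
    then show "vlift M u v d' = 0" by (auto simp: vlift_def velocity_def)
  qed
qed

lemma rho_vlift:
  assumes "u \<in> slit_bundle M" "v \<in> tangent_space M (fst u)"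
  shows "rho M u (vlift M u v) = 0"
proof
  fix c
  show "rho M u (vlift M u v) c = 0 c"
  proof (cases "c \<in> M \<and> fst u \<in> fst c")
    case True
    then show ?thesis
      using rho_component[OF vlift_tangent[OF assms], of c] vlift_component[OF assms(1)] assms(1)
      by (simp add: fst_sc)
  qed (simp add: rho_outside)
qed

lemma slit_openin_subset: "openin (atlas_topology (slit_atlas M)) U \<Longrightarrow> U \<subseteq> slit_bundle M"
  using slit.openin_iff slit_carrier by auto

lemma pi_sections_iff:
  assumes U: "openin (atlas_topology (slit_atlas M)) U"
  shows "Y \<in> pi_sections M U \<longleftrightarrow> (\<forall>u\<in>U. Y u \<in> tangent_space M (fst u)) \<and>
    (\<forall>c\<in>M. smooth_on (snd (sc c) ` (U \<inter> fst (sc c))) (\<lambda>z. Y (chart_inv (sc c) z) c))"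
proof -
  have "smooth_fun (slit_atlas M) (U \<inter> {u. fst u \<in> fst c}) (\<lambda>u. Y u c)
    \<longleftrightarrow> smooth_on (snd (sc c) ` (U \<inter> fst (sc c))) (\<lambda>z. Y (chart_inv (sc c) z) c)" if c: "c \<in> M" for c
  proof -
    have eq: "U \<inter> {u. fst u \<in> fst c} = U \<inter> fst (sc c)"
      using slit_openin_subset[OF U] by (auto simp: fst_sc)
    have o: "openin (atlas_topology (slit_atlas M)) (U \<inter> fst (sc c))"
      using openin_Int[OF U slit.openin_chart[OF sc_in[OF c]]] .
    show ?thesis
      using slit.smooth_fun_chartI[OF o sc_in[OF c], of "\<lambda>u. Y u c"]
        slit.smooth_fun_subset_chart[OF _ sc_in[OF c], of "U \<inter> fst (sc c)" "\<lambda>u. Y u c"]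
      unfolding eq by (auto simp: comp_def)
  qed
  then show ?thesis by (auto simp: pi_sections_def)
qed

lemma slit_vector_fields_iff:
  assumes U: "openin (atlas_topology (slit_atlas M)) U"
  shows "X \<in> vector_fields (slit_atlas M) U \<longleftrightarrow> (\<forall>u\<in>U. X u \<in> ST u) \<and>
    (\<forall>c\<in>M. smooth_on (snd (sc c) ` (U \<inter> fst (sc c))) (\<lambda>z. X (chart_inv (sc c) z) (sc c)))"
  unfolding slit.vector_fields_iff[OF U] by (simp add: slit_atlas_def)

lemma pi_sections_tangent: "Y \<in> pi_sections M U \<Longrightarrow> u \<in> U \<Longrightarrow> Y u \<in> tangent_space M (fst u)"
  by (auto simp: pi_sections_def)

lemma vector_fields_tangent: "X \<in> vector_fields (slit_atlas M) U \<Longrightarrow> u \<in> U \<Longrightarrow> X u \<in> ST u"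
  by (auto simp: vector_fields_def)

lemma eta_pi_section:
  assumes U: "openin (atlas_topology (slit_atlas M)) U"
  shows "eta \<in> pi_sections M U"
  unfolding pi_sections_iff[OF U]
proof (intro conjI ballI)
  show "eta u \<in> tangent_space M (fst u)" if "u \<in> U" for u
    using slit_openin_subset[OF U] that by (auto simp: eta_def slit_bundle_tangent)
next
  fix c assume c: "c \<in> M"
  have "open (snd (sc c) ` (U \<inter> fst (sc c)))" using slit.openin_open[OF U sc_in[OF c]] .
  then show "smooth_on (snd (sc c) ` (U \<inter> fst (sc c))) (\<lambda>z. eta (chart_inv (sc c) z) c)"
    by (rule smooth_on_cong[OF _ _ smooth_on_linear[OF bounded_linear_snd]])
      (use c in \<open>auto simp: sc_inv eta_def\<close>, simp add: snd_sc)
qed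

lemma zero_pi_section:
  assumes U: "openin (atlas_topology (slit_atlas M)) U"
  shows "(\<lambda>u. 0) \<in> pi_sections M U"
  unfolding pi_sections_iff[OF U] by (simp add: zero_tangent_space smooth_on_const)

lemma diff_pi_section:
  assumes U: "openin (atlas_topology (slit_atlas M)) U" and "Y \<in> pi_sections M U" "Z \<in> pi_sections M U"
  shows "(\<lambda>u. Y u - Z u) \<in> pi_sections M U"
  using assms(2,3) unfolding pi_sections_iff[OF U]
  by (auto simp: diff_tangent_space intro!: smooth_on_diff slit.openin_open[OF U sc_in])

lemma gamma_vector_field:
  assumes U: "openin (atlas_topology (slit_atlas M)) U" and X: "X \<in> pi_sections M U"
  shows "gamma_field M X \<in> vector_fields (slit_atlas M) U"
  unfolding slit_vector_fields_iff[OF U]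
proof (intro conjI ballI)
  show "gamma_field M X u \<in> ST u" if "u \<in> U" for u
    using slit_openin_subset[OF U] that pi_sections_tangent[OF X that]
    by (auto simp: gamma_field_def vlift_tangent)
next
  fix c assume c: "c \<in> M"
  have o: "open (snd (sc c) ` (U \<inter> fst (sc c)))" using slit.openin_open[OF U sc_in[OF c]] .
  show "smooth_on (snd (sc c) ` (U \<inter> fst (sc c))) (\<lambda>z. gamma_field M X (chart_inv (sc c) z) (sc c))"
  proof (rule smooth_on_cong[OF o])
    show "smooth_on (snd (sc c) ` (U \<inter> fst (sc c))) (\<lambda>z. (0 :: 'e, X (chart_inv (sc c) z) c))"
      using X c by (intro smooth_on_Pair[OF o] smooth_on_const) (simp add: pi_sections_iff[OF U])
  qed (use c slit_openin_subset[OF U] in \<open>auto simp: sc_inv gamma_field_def vlift_component fst_sc\<close>)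
qed

lemma rho_pi_section:
  assumes U: "openin (atlas_topology (slit_atlas M)) U" and X: "X \<in> vector_fields (slit_atlas M) U"
  shows "(\<lambda>u. rho M u (X u)) \<in> pi_sections M U"
  unfolding pi_sections_iff[OF U]
proof (intro conjI ballI)
  show "rho M u (X u) \<in> tangent_space M (fst u)" if "u \<in> U" for u
    using slit_openin_subset[OF U] that vector_fields_tangent[OF X that] by (auto intro: rho_tangent)
next
  fix c assume c: "c \<in> M"
  have o: "open (snd (sc c) ` (U \<inter> fst (sc c)))" using slit.openin_open[OF U sc_in[OF c]] .
  show "smooth_on (snd (sc c) ` (U \<inter> fst (sc c))) (\<lambda>z. rho M (chart_inv (sc c) z) (X (chart_inv (sc c) z)) c)"
  proof (rule smooth_on_cong[OF o])
    show "smooth_on (snd (sc c) ` (U \<inter> fst (sc c))) (\<lambda>z. fst (X (chart_inv (sc c) z) (sc c)))"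
      using X c by (intro smooth_on_linear_compose[OF bounded_linear_fst o]) (simp add: slit_vector_fields_iff[OF U])
  qed (use c vector_fields_tangent[OF X] in \<open>auto simp: sc_inv rho_component\<close>)
qed

end

section \<open>Connections on the pullback bundle\<close>

context base_atlas
begin

lemma pi_sections_cong:
  assumes "openin (atlas_topology (slit_atlas M)) U" "Y \<in> pi_sections M U" "\<And>u. u \<in> U \<Longrightarrow> Y u = Z u"
  shows "Z \<in> pi_sections M U"
  unfolding pi_sections_iff[OF assms(1)]
proof (intro conjI ballI)
  show "Z u \<in> tangent_space M (fst u)" if "u \<in> U" for u
    using assms(2,3) that by (metis pi_sections_tangent)
next
  fix c assume c: "c \<in> M"
  show "smooth_on (snd (sc c) ` (U \<inter> fst (sc c))) (\<lambda>z. Z (chart_inv (sc c) z) c)"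
    by (rule smooth_on_cong[OF slit.openin_open[OF assms(1) sc_in[OF c]],
          where f = "\<lambda>z. Y (chart_inv (sc c) z) c"])
      (use assms c in \<open>auto simp: pi_sections_iff sc_inv\<close>)
qed

end

locale pullback_connection = base_atlas M
  for M :: "('a, 'e::euclidean_space) chart set" +
  fixes D :: "('a, 'e) connection"
  assumes connection: "is_connection M D"
begin

lemmas conn_axioms = connection[unfolded is_connection_def, THEN spec, THEN mp]
lemmas conn_tangent = conn_axioms[THEN conjunct1, rule_format]
lemmas conn_linear = conn_axioms[THEN conjunct2, THEN conjunct1, rule_format]
lemmas conn_add = conn_axioms[THEN conjunct2, THEN conjunct2, THEN conjunct1, rule_format]
lemmas conn_leibniz = conn_axioms[THEN conjunct2, THEN conjunct2, THEN conjunct2, THEN conjunct1, rule_format]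
lemmas conn_section = conn_axioms[THEN conjunct2, THEN conjunct2, THEN conjunct2, THEN conjunct2, rule_format]

text \<open>Multiplying by the indicator function of \<open>U\<close>, which is smooth on \<open>U\<close> with vanishing
  derivative, replaces a section by one that vanishes off \<open>U\<close> without changing its derivative.\<close>

lemma conn_local:
  assumes U: "openin (atlas_topology (slit_atlas M)) U" and Y: "Y \<in> pi_sections M U"
    and eq: "\<And>w. w \<in> U \<Longrightarrow> Y w = Z w" and u: "u \<in> U" and \<xi>: "\<xi> \<in> ST u"
  shows "D u \<xi> Y = D u \<xi> Z"
proof -
  let ?f = "\<lambda>w. if w \<in> U then 1 else 0 :: real"
  have one: "(?f \<circ> chart_inv c) x = 1" if "c \<in> slit_atlas M" "x \<in> snd c ` (U \<inter> fst c)" for c x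
    using that by auto
  have f: "smooth_fun (slit_atlas M) U ?f"
    unfolding smooth_fun_def
  proof
    fix c assume c: "c \<in> slit_atlas M"
    show "smooth_on (snd c ` (U \<inter> fst c)) (?f \<circ> chart_inv c)"
      by (rule smooth_on_cong[OF slit.openin_open[OF U c] _ smooth_on_const[of _ 1]]) (use one[OF c] in metis)
  qed
  obtain c where c: "c \<in> M" "u \<in> fst (sc c)" "chart_at (slit_atlas M) u = sc c"
    using slit_chart_at u slit_openin_subset[OF U] by blast
  have "frechet_derivative (?f \<circ> chart_inv (sc c)) (at (snd (sc c) u)) = frechet_derivative (\<lambda>x. 1) (at (snd (sc c) u))"
    by (rule frechet_derivative_local[OF slit.openin_open[OF U sc_in[OF c(1)]]])
      (use c u one[OF sc_in[OF c(1)]] in auto)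
  then have d: "dir_deriv (slit_atlas M) u \<xi> ?f = 0"
    by (simp add: dir_deriv_def Let_def c(3))
  have *: "D u \<xi> (\<lambda>w. ?f w *\<^sub>R W w) = D u \<xi> W" if "W \<in> pi_sections M U" for W
    using conn_leibniz[OF U f that u \<xi>] d u by simp
  have "(\<lambda>w. ?f w *\<^sub>R Y w) = (\<lambda>w. ?f w *\<^sub>R Z w)" using eq by auto
  then show ?thesis using *[OF Y] *[OF pi_sections_cong[OF U Y eq]] by metis
qed

lemma conn_zero:
  assumes "u \<in> slit_bundle M" "\<xi> \<in> ST u"
  shows "D u \<xi> (\<lambda>w. 0) = 0"
  using conn_add[OF openin_slit_bundle zero_pi_section zero_pi_section assms] openin_slit_bundle by simp

abbreviation "K \<equiv> connection_map D"

lemma K_tangent: "u \<in> slit_bundle M \<Longrightarrow> \<xi> \<in> ST u \<Longrightarrow> K u \<xi> \<in> tangent_space M (fst u)"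
  unfolding connection_map_def
  by (rule conn_tangent[OF openin_slit_bundle eta_pi_section[OF openin_slit_bundle]])

lemma K_linear:
  "u \<in> slit_bundle M \<Longrightarrow> \<xi> \<in> ST u \<Longrightarrow> \<zeta> \<in> ST u
    \<Longrightarrow> K u (a *\<^sub>R \<xi> + b *\<^sub>R \<zeta>) = a *\<^sub>R K u \<xi> + b *\<^sub>R K u \<zeta>"
  unfolding connection_map_def
  by (rule conn_linear[OF openin_slit_bundle eta_pi_section[OF openin_slit_bundle]])

lemma K_section:
  "X \<in> vector_fields (slit_atlas M) (slit_bundle M) \<Longrightarrow> (\<lambda>u. K u (X u)) \<in> pi_vector_fields M"
  unfolding connection_map_def
  by (rule conn_section[OF openin_slit_bundle _ eta_pi_section[OF openin_slit_bundle]])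

text \<open>The connection map of the tangent vector with components \<open>h\<close>, in a chart. It is linear in
  \<open>h\<close> and smooth in the point, which is what the smoothness of horizontal lifts rests on.\<close>

definition Kcoeff :: "('a, 'e) chart \<Rightarrow> 'e \<times> 'e \<Rightarrow> 'e \<times> 'e \<Rightarrow> 'e" where
  "Kcoeff c h z = (let u = chart_inv (sc c) z in K u (slit.tangent_of u (sc c) h) c)"

lemma Kcoeff_smooth:
  assumes c: "c \<in> M"
  shows "smooth_on (snd (sc c) ` fst (sc c)) (Kcoeff c h)"
proof -
  have U: "openin (atlas_topology (slit_atlas M)) (fst (sc c))" by (rule slit.openin_chart[OF sc_in[OF c]])
  have "(\<lambda>u. K u (slit.tangent_of u (sc c) h)) \<in> pi_sections M (fst (sc c))"
    unfolding connection_map_def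
    by (rule conn_section[OF U slit.coordinate_field[OF sc_in[OF c]] eta_pi_section[OF U]])
  then show ?thesis
    using c unfolding pi_sections_iff[OF U] Kcoeff_def Let_def by auto
qed

lemma Kcoeff_linear:
  assumes c: "c \<in> M" and u: "u \<in> fst (sc c)"
  shows "linear (\<lambda>h. Kcoeff c h (snd (sc c) u))"
proof -
  let ?E = "slit.tangent_of u (sc c)"
  have E: "?E h \<in> ST u" for h using c u by (intro slit.tangent_of_in sc_in)
  have Eu: "?E h (sc c) = h" for h using c u by (intro slit.tangent_of_same sc_in)
  have "?E (a *\<^sub>R h + b *\<^sub>R k) = a *\<^sub>R ?E h + b *\<^sub>R ?E k" for a b h k
    by (rule slit.tangent_space_eqI[OF E slit.combination_tangent_space[OF E E] sc_in[OF c] u])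
      (simp add: Eu scaleR_fun_def)
  then have *: "Kcoeff c (a *\<^sub>R h + b *\<^sub>R k) (snd (sc c) u)
      = a *\<^sub>R Kcoeff c h (snd (sc c) u) + b *\<^sub>R Kcoeff c k (snd (sc c) u)" for a b h k
    using c u K_linear[OF _ E E] by (simp add: Kcoeff_def sc_inv fst_sc scaleR_fun_def)
  show ?thesis
    by (rule linearI) (use *[of 1 _ 1] *[of _ _ 0] in auto)
qed

lemma K_component:
  assumes c: "c \<in> M" and u: "u \<in> fst (sc c)" and \<xi>: "\<xi> \<in> ST u"
  shows "K u \<xi> c = Kcoeff c (\<xi> (sc c)) (snd (sc c) u)"
  using slit.tangent_of_component[OF \<xi> sc_in[OF c] u] c u by (simp add: Kcoeff_def sc_inv)

end

locale regular_connection = pullback_connection M D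
  for M :: "('a, 'e::euclidean_space) chart set" and D +
  assumes regular: "is_regular M D"
begin

lemma vertical_horizontal_zero:
  assumes "u \<in> slit_bundle M" "\<xi> \<in> ST u" "rho M u \<xi> = 0" "K u \<xi> = 0"
  shows "\<xi> = 0"
  using regular assms unfolding is_regular_def vertical_space_def horizontal_space_def by blast

text \<open>Since vertical vectors are killed by \<^const>\<open>rho\<close>, the horizontal part of any vector over \<open>v\<close>
  is a horizontal vector over \<open>v\<close>.\<close>

lemma hlift:
  assumes u: "u \<in> slit_bundle M" and v: "v \<in> tangent_space M (fst u)"
  shows "hlift M D u v \<in> ST u" "rho M u (hlift M D u v) = v" "K u (hlift M D u v) = 0"
proof -
  obtain c where c: "c \<in> M" "u \<in> fst (sc c)" using slit_bundle_chart u by blast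
  let ?\<xi> = "slit.tangent_of u (sc c) (v c, 0)"
  have \<xi>: "?\<xi> \<in> ST u" using c by (intro slit.tangent_of_in sc_in)
  have "rho M u ?\<xi> c = v c" using rho_component[OF \<xi> c] slit.tangent_of_same[OF sc_in[OF c(1)] c(2)] by simp
  moreover have "fst u \<in> fst c" using c by (simp add: fst_sc)
  ultimately have rho: "rho M u ?\<xi> = v"
    by (intro tangent_space_eqI[OF rho_tangent[OF \<xi> u] v c(1)])
  have "?\<xi> \<in> {\<alpha> + \<zeta> | \<alpha> \<zeta>. \<alpha> \<in> vertical_space M u \<and> \<zeta> \<in> horizontal_space M D u}"
    using bspec[OF regular[unfolded is_regular_def] u, THEN conjunct1] \<xi> by (simp only:)
  then obtain \<alpha> \<zeta> where d: "?\<xi> = \<alpha> + \<zeta>" "\<alpha> \<in> ST u" "rho M u \<alpha> = 0" "\<zeta> \<in> horizontal_space M D u"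
    unfolding vertical_space_def mem_Collect_eq by metis
  have "v = rho M u \<zeta>"
    using rho_linear[of \<alpha> u \<zeta> 1 1] d rho u unfolding horizontal_space_def by auto
  then have "v \<in> rho M u ` horizontal_space M D u" using d by auto
  from inv_into_into[OF this] f_inv_into_f[OF this]
  show "hlift M D u v \<in> ST u" "rho M u (hlift M D u v) = v" "K u (hlift M D u v) = 0"
    unfolding hlift_def horizontal_space_def by auto
qed

lemma hlift_unique:
  assumes u: "u \<in> slit_bundle M" and \<xi>: "\<xi> \<in> ST u" "K u \<xi> = 0"
  shows "hlift M D u (rho M u \<xi>) = \<xi>"
proof -
  have v: "rho M u \<xi> \<in> tangent_space M (fst u)" using \<xi> u by (intro rho_tangent)
  let ?h = "hlift M D u (rho M u \<xi>)"
  have "1 *\<^sub>R ?h + (-1) *\<^sub>R \<xi> = 0"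
    using hlift[OF u v] u \<xi>
    by (intro vertical_horizontal_zero[OF u]) (simp_all only: rho_linear K_linear slit.combination_tangent_space, simp_all)
  then show ?thesis by simp
qed

end

text \<open>In a chart, the horizontal lift of \<open>X\<close> is \<open>(X, w)\<close>, where \<open>w\<close> solves a linear system whose
  coefficients are those of the connection map. The system is nonsingular because the connection
  is regular, and Cramer's rule exhibits its solution as a smooth function.\<close>

lemma beta_vector_field:
  fixes M :: "('a, real ^ 'n) chart set"
  assumes "regular_connection M D"
    and U: "openin (atlas_topology (slit_atlas M)) U" and X: "X \<in> pi_sections M U"
  shows "beta_field M D X \<in> vector_fields (slit_atlas M) U"
proof -
  interpret regular_connection M D by (rule assms(1))
  note US = slit_openin_subset[OF U]
  have XT: "X u \<in> tangent_space M (fst u)" if "u \<in> U" for u using pi_sections_tangent[OF X that] .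
  show ?thesis
    unfolding slit_vector_fields_iff[OF U]
  proof (intro conjI ballI)
    show "beta_field M D X u \<in> ST u" if "u \<in> U" for u
      unfolding beta_field_def by (rule hlift(1)) (use US XT that in auto)
  next
    fix c assume c: "c \<in> M"
    let ?S = "snd (sc c) ` (U \<inter> fst (sc c))"
    have o: "open ?S" using slit.openin_open[OF U sc_in[OF c]] .
    \<comment> \<open>The horizontality condition for \<open>(x, w)\<close> reads \<open>N w = b\<close>.\<close>
    define x where "x z = X (chart_inv (sc c) z) c" for z
    define k where "k h z = Kcoeff c h z" for h z
    define N where "N z = matrix (\<lambda>w. k (0, w) z)" for z
    define b where "b z = - k (x z, 0) z" for z
    define w where "w z = (\<chi> l. det (\<chi> i j. if j = l then b z $ i else N z $ i $ j) / det (N z))" for z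
    have klin: "linear (\<lambda>h. k h z)" if "z \<in> ?S" for z
      using that Kcoeff_linear[OF c] by (auto simp: k_def)
    have k0lin: "linear (\<lambda>y. k (0, y) z)" "linear (\<lambda>y. k (y, 0) z)" if "z \<in> ?S" for z
      using linear_compose[OF _ klin[OF that], of "\<lambda>y. (0, y)"] linear_compose[OF _ klin[OF that], of "\<lambda>y. (y, 0)"]
      by (auto simp: comp_def linear_iff)
    have ksm: "smooth_on ?S (k h)" for h
      unfolding k_def by (rule smooth_on_subset[OF Kcoeff_smooth[OF c]]) auto
    have detN: "det (N z) \<noteq> 0" if z: "z \<in> ?S" for z
    proof -
      obtain u where u: "u \<in> U" "u \<in> fst (sc c)" "z = snd (sc c) u" using z by auto
      have us: "u \<in> slit_bundle M" using u US by auto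
      \<comment> \<open>A kernel vector of \<open>N\<close> is a tangent vector that is both vertical and horizontal.\<close>
      have "y = 0" if "k (0, y) z = 0" for y
      proof -
        let ?\<xi> = "slit.tangent_of u (sc c) (0, y)"
        have \<xi>: "?\<xi> \<in> ST u" "?\<xi> (sc c) = (0, y)"
          using slit.tangent_of_in[OF sc_in[OF c] u(2)] slit.tangent_of_same[OF sc_in[OF c] u(2)] by auto
        have fc: "fst u \<in> fst c" using u by (simp add: fst_sc)
        have "K u ?\<xi> c = 0" using K_component[OF c u(2) \<xi>(1)] \<xi>(2) that u(3) by (simp add: k_def)
        then have K0: "K u ?\<xi> = 0"
          by (intro tangent_space_eqI[OF K_tangent[OF us \<xi>(1)] zero_tangent_space c fc]) simp
        have "rho M u ?\<xi> c = 0" using rho_component[OF \<xi>(1) c u(2)] \<xi>(2) by simp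
        then have "rho M u ?\<xi> = 0"
          by (intro tangent_space_eqI[OF rho_tangent[OF \<xi>(1) us] zero_tangent_space c fc]) simp
        then have "?\<xi> = 0" by (rule vertical_horizontal_zero[OF us \<xi>(1) _ K0])
        then show "y = 0" using \<xi>(2) by (metis prod.inject zero_fun_apply zero_prod_def)
      qed
      then have "inj (\<lambda>y. k (0, y) z)" using linear_injective_0[OF k0lin(1)[OF z]] by blast
      then show ?thesis using det_nz_iff_inj[OF k0lin(1)[OF z]] by (simp add: N_def)
    qed
    have Nsm: "smooth_on ?S (\<lambda>z. N z $ i $ j)" for i j
      unfolding N_def matrix_def
      using ksm by (simp add: smooth_on_vec_iff[OF o])
    have xsm: "smooth_on ?S x" using X c unfolding pi_sections_iff[OF U] x_def by auto
    have bsm: "smooth_on ?S b"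
      unfolding b_def
    proof (rule smooth_on_minus[OF o], rule smooth_on_cong[OF o])
      show "smooth_on ?S (\<lambda>z. \<Sum>e\<in>Basis. (x z \<bullet> e) *\<^sub>R k (e, 0) z)"
        by (intro smooth_on_sum[OF o] smooth_on_bilinear[OF bounded_bilinear_scaleR o] ksm
            smooth_on_linear_compose[OF bounded_linear_inner_left o xsm])
      show "(\<Sum>e\<in>Basis. (x z \<bullet> e) *\<^sub>R k (e, 0) z) = k (x z, 0) z" if "z \<in> ?S" for z
        by (rule linear_euclidean_sum[OF k0lin(2)[OF that], symmetric])
    qed
    have "smooth_on ?S (\<lambda>z. if j = l then b z $ i else N z $ i $ j)" for i j l
      using bsm Nsm by (cases "j = l") (simp_all add: smooth_on_vec_iff[OF o])
    then have "smooth_on ?S (\<lambda>z. det (\<chi> i j. if j = l then b z $ i else N z $ i $ j))" for l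
      by (intro smooth_on_det[OF o]) (simp only: vec_lambda_beta)
    then have wsm: "smooth_on ?S w"
      unfolding w_def smooth_on_vec_iff[OF o] vec_lambda_beta
      by (intro allI smooth_on_divide[OF o] smooth_on_det[OF o Nsm] detN)
    show "smooth_on ?S (\<lambda>z. beta_field M D X (chart_inv (sc c) z) (sc c))"
    proof (rule smooth_on_cong[OF o])
      show "smooth_on ?S (\<lambda>z. (x z, w z))" by (rule smooth_on_Pair[OF o xsm wsm])
    next
      fix z assume z: "z \<in> ?S"
      then obtain u where u: "u \<in> U" "u \<in> fst (sc c)" "z = snd (sc c) u" by auto
      have us: "u \<in> slit_bundle M" using u US by auto
      have cu: "chart_inv (sc c) z = u" using sc_inv[OF c u(2)] u(3) by simp
      note h = hlift[OF us XT[OF u(1)]]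
      let ?h = "hlift M D u (X u) (sc c)"
      have fh: "fst ?h = x z" using rho_component[OF h(1) c u(2)] h(2) cu by (simp add: x_def)
      have "k ?h z = 0" using K_component[OF c u(2) h(1)] h(3) u(3) by (simp add: k_def)
      moreover have "k ?h z = k (x z, 0) z + k (0, snd ?h) z"
        using linear_add[OF klin[OF z], of "(x z, 0)" "(0, snd ?h)"] fh by (metis add.left_neutral add.right_neutral add_Pair prod.collapse)
      moreover have "N z *v snd ?h = k (0, snd ?h) z"
        unfolding N_def by (rule matrix_works[OF k0lin(1)[OF z, folded linear_matrix_vector_mul_eq]])
      ultimately have "N z *v snd ?h = b z" by (simp add: b_def eq_neg_iff_add_eq_0 add.commute)
      then have "snd ?h = w z" using cramer[OF detN[OF z]] by (simp add: w_def)
      then show "(x z, w z) = beta_field M D X (chart_inv (sc c) z) (sc c)"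
        using fh by (simp add: beta_field_def cu prod_eq_iff)
    qed
  qed
qed

section \<open>The fundamental tensor in charts\<close>

lemma line_derivative:
  fixes f :: "'e::euclidean_space \<Rightarrow> real"
  assumes "open S" "smooth_on S f" "z \<in> S" "\<And>t. z + t *\<^sub>R h \<in> S \<Longrightarrow> \<phi> t = f (z + t *\<^sub>R h)"
  shows "(\<phi> has_real_derivative frechet_derivative f (at z) h) (at 0)"
proof -
  have l: "((\<lambda>t. z + t *\<^sub>R h) has_derivative (\<lambda>k. k *\<^sub>R h)) (at 0)"
    by (auto intro!: derivative_eq_intros)
  have d: "(f has_derivative frechet_derivative f (at z)) (at (z + 0 *\<^sub>R h))"
    using smooth_on_has_derivative[OF assms(2,3)] by simp
  have lin: "linear (frechet_derivative f (at z))" by (rule smooth_on_linear_derivative[OF assms(2,3)])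
  have "((\<lambda>t. f (z + t *\<^sub>R h)) has_real_derivative frechet_derivative f (at z) h) (at 0)"
    unfolding has_field_derivative_def
    by (rule has_derivative_eq_rhs[OF has_derivative_compose[OF l d]]) (simp add: linear_scale[OF lin] fun_eq_iff)
  moreover have "open ((\<lambda>t. z + t *\<^sub>R h) -` S)"
    by (intro open_vimage assms continuous_intros)
  ultimately show ?thesis
    by (rule has_field_derivative_transform_within_open) (use assms(3,4) in auto)
qed

context base_atlas
begin

lemma slit_fibre_point:
  assumes "c \<in> M" "u \<in> fst (sc c)" "v \<in> tangent_space M (fst u)" "v c \<noteq> 0"
  shows "(fst u, v) \<in> fst (sc c)" "chart_inv (sc c) (snd c (fst u), v c) = (fst u, v)"
proof -
  show 1: "(fst u, v) \<in> fst (sc c)"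
    using assms by (auto simp: fst_sc slit_bundle_def)
  show "chart_inv (sc c) (snd c (fst u), v c) = (fst u, v)"
    using sc_inv[OF assms(1) 1] by (simp add: snd_sc)
qed

lemma sc_image: "c \<in> M \<Longrightarrow> snd (sc c) ` fst (sc c) = snd c ` fst c \<times> (- {0})"
  using sc_overlap[of c c] by simp

definition energy :: "(('a, 'e) tpoint \<Rightarrow> real) \<Rightarrow> ('a, 'e) chart \<Rightarrow> 'e \<times> 'e \<Rightarrow> real" where
  "energy L c z = (L (chart_inv (sc c) z))\<^sup>2 / 2"

lemma energy_smooth:
  assumes "finsler_structure M L" "c \<in> M"
  shows "smooth_on (snd (sc c) ` fst (sc c)) (energy L c)"
proof -
  have "smooth_fun (slit_atlas M) (slit_bundle M) L"
    using assms(1) by (simp add: finsler_structure_def)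
  then have "smooth_on (snd (sc c) ` (slit_bundle M \<inter> fst (sc c))) (L \<circ> chart_inv (sc c))"
    using sc_in[OF assms(2)] by (simp add: smooth_fun_def)
  moreover have "slit_bundle M \<inter> fst (sc c) = fst (sc c)" by (auto simp: fst_sc)
  ultimately have L: "smooth_on (snd (sc c) ` fst (sc c)) (\<lambda>z. L (chart_inv (sc c) z))"
    by (simp add: comp_def)
  have "smooth_on (snd (sc c) ` fst (sc c)) (\<lambda>z. L (chart_inv (sc c) z) * L (chart_inv (sc c) z) / 2)"
    by (intro smooth_on_divide smooth_on_bilinear[OF bounded_bilinear_mult] open_sc assms L smooth_on_const) simp
  then show ?thesis by (simp add: energy_def[abs_def] power2_eq_square)
qed

text \<open>In a chart, the fundamental tensor is the Hessian of the energy in the fibre variables. The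
  two nested derivatives along lines stay inside the slit bundle because its charts are open.\<close>

lemma fund_tensor_energy:
  assumes L: "finsler_structure M L" and c: "c \<in> M" and u: "u \<in> fst (sc c)"
    and v: "v \<in> tangent_space M (fst u)" and w: "w \<in> tangent_space M (fst u)"
  shows "fund_tensor L u v w = frechet_derivative (\<lambda>z. frechet_derivative (energy L c) (at z) (0, w c))
    (at (snd (sc c) u)) (0, v c)"
proof -
  let ?S = "snd (sc c) ` fst (sc c)" and ?z = "snd (sc c) u"
  let ?f = "\<lambda>z. frechet_derivative (energy L c) (at z) (0, w c)"
  have ut: "snd u \<in> tangent_space M (fst u)" using u by (simp add: fst_sc slit_bundle_tangent)
  have sm: "smooth_on ?S (energy L c)" by (rule energy_smooth[OF L c])
  have o: "open ?S" by (rule open_sc[OF c])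
  have "deriv (\<lambda>t. (L (fst u, snd u + s *\<^sub>R v + t *\<^sub>R w))\<^sup>2 / 2) 0 = ?f (?z + s *\<^sub>R (0, v c))"
    if s: "?z + s *\<^sub>R (0, v c) \<in> ?S" for s
  proof (rule DERIV_imp_deriv, rule line_derivative[OF o sm s])
    fix t assume "?z + s *\<^sub>R (0, v c) + t *\<^sub>R (0, w c) \<in> ?S"
    then have nz: "(snd u + s *\<^sub>R v + t *\<^sub>R w) c \<noteq> 0"
      unfolding sc_image[OF c] by (auto simp: snd_sc scaleR_fun_def)
    have "1 *\<^sub>R (1 *\<^sub>R snd u + s *\<^sub>R v) + t *\<^sub>R w \<in> tangent_space M (fst u)"
      by (intro combination_tangent_space ut v w)
    then have T: "snd u + s *\<^sub>R v + t *\<^sub>R w \<in> tangent_space M (fst u)" by simp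
    have "?z + s *\<^sub>R (0, v c) + t *\<^sub>R (0, w c) = (snd c (fst u), (snd u + s *\<^sub>R v + t *\<^sub>R w) c)"
      by (simp add: snd_sc scaleR_fun_def)
    then show "(L (fst u, snd u + s *\<^sub>R v + t *\<^sub>R w))\<^sup>2 / 2 = energy L c (?z + s *\<^sub>R (0, v c) + t *\<^sub>R (0, w c))"
      using slit_fibre_point(2)[OF c u T nz] by (simp only: energy_def)
  qed
  note inner = this
  have zS: "?z \<in> ?S" using u by (rule imageI)
  show ?thesis
    unfolding fund_tensor_def
    by (rule DERIV_imp_deriv, rule line_derivative[OF o smooth_on_partial[OF sm] zS], rule inner)
qed

lemma fund_tensor_symmetric:
  assumes L: "finsler_structure M L" and u: "u \<in> slit_bundle M"
    and v: "v \<in> tangent_space M (fst u)" and w: "w \<in> tangent_space M (fst u)"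
  shows "fund_tensor L u v w = fund_tensor L u w v"
proof -
  obtain c where c: "c \<in> M" "u \<in> fst (sc c)" using slit_bundle_chart u by blast
  show ?thesis
    unfolding fund_tensor_energy[OF L c v w] fund_tensor_energy[OF L c w v]
    by (rule symmetric_second_derivative_real[OF open_sc[OF c(1)] energy_smooth[OF L c(1)]]) (use c in auto)
qed

lemma fund_tensor_diff_left:
  assumes L: "finsler_structure M L" and u: "u \<in> slit_bundle M"
    and v: "v \<in> tangent_space M (fst u)" "v' \<in> tangent_space M (fst u)" and w: "w \<in> tangent_space M (fst u)"
  shows "fund_tensor L u (v - v') w = fund_tensor L u v w - fund_tensor L u v' w"
proof -
  obtain c where c: "c \<in> M" "u \<in> fst (sc c)" using slit_bundle_chart u by blast
  have lin: "linear (frechet_derivative (\<lambda>z. frechet_derivative (energy L c) (at z) (0, w c)) (at (snd (sc c) u)))"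
    by (rule smooth_on_linear_derivative[OF smooth_on_partial[OF energy_smooth[OF L c(1)]]]) (use c in auto)
  show ?thesis
    unfolding fund_tensor_energy[OF L c v(1) w] fund_tensor_energy[OF L c v(2) w]
      fund_tensor_energy[OF L c diff_tangent_space[OF v] w] linear_diff[OF lin, symmetric]
    by simp
qed

text \<open>Euler's relation: the fibre derivative of the energy is homogeneous of degree one, so its
  derivative in the radial direction is itself.\<close>

lemma fund_tensor_eta:
  assumes L: "finsler_structure M L" and c: "c \<in> M" and u: "u \<in> fst (sc c)"
    and w: "w \<in> tangent_space M (fst u)"
  shows "fund_tensor L u (eta u) w = frechet_derivative (energy L c) (at (snd (sc c) u)) (0, w c)"
proof -
  let ?S = "snd (sc c) ` fst (sc c)"
  obtain x y where z: "snd (sc c) u = (x, y)" by fastforce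
  have y: "y = snd u c" "x = snd c (fst u)" using z by (auto simp: snd_sc)
  have zS: "(x, y) \<in> ?S" using u z by (metis imageI)
  have ut: "snd u \<in> tangent_space M (fst u)" using u by (simp add: fst_sc slit_bundle_tangent)
  have sm: "smooth_on ?S (energy L c)" by (rule energy_smooth[OF L c])
  have o: "open ?S" by (rule open_sc[OF c])
  let ?d = "\<lambda>z. frechet_derivative (energy L c) (at z) (0, w c)"
  have xS: "x \<in> snd c ` fst c" using zS unfolding sc_image[OF c] by auto
  have hom: "energy L c (x, a *\<^sub>R y') = a\<^sup>2 * energy L c (x, y')" if a: "a > 0" and S: "(x, y') \<in> ?S" for a y'
  proof -
    have y': "y' \<noteq> 0" using S unfolding sc_image[OF c] by auto
    have fc: "fst u \<in> fst c" using u by (simp add: fst_sc)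
    let ?v = "tangent_of (fst u) c y'"
    have v: "?v \<in> tangent_space M (fst u)" "?v c = y'" using c fc by (auto intro: tangent_of_in)
    have av: "a *\<^sub>R ?v \<in> tangent_space M (fst u)" using v by (intro scaleR_tangent_space)
    have avc: "(a *\<^sub>R ?v) c = a *\<^sub>R y'" using v by (simp add: scaleR_fun_def)
    have "chart_inv (sc c) (x, y') = (fst u, ?v)" "chart_inv (sc c) (x, a *\<^sub>R y') = (fst u, a *\<^sub>R ?v)"
      using slit_fibre_point(2)[OF c u v(1)] slit_fibre_point(2)[OF c u av] v(2) avc y' a y(2) by auto
    moreover have "(fst u, ?v) \<in> tangent_bundle M" using u v by (auto simp: tangent_bundle_def fst_sc slit_bundle_def)
    ultimately show ?thesis
      using L a unfolding finsler_structure_def by (auto simp: energy_def power_mult_distrib)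
  qed
  \<comment> \<open>Differentiate both sides of \<open>hom\<close> at \<open>y\<close> in the direction \<open>w / a\<close>.\<close>
  have d: "?d (x, a *\<^sub>R y) = a * ?d (x, y)" if a: "a > 0" for a
  proof -
    have azS: "(x, a *\<^sub>R y) \<in> ?S" using zS a unfolding sc_image[OF c] by auto
    let ?\<phi> = "\<lambda>t. a\<^sup>2 * energy L c (x, y + (t / a) *\<^sub>R w c)"
    have "(?\<phi> has_real_derivative ?d (x, a *\<^sub>R y)) (at 0)"
    proof (rule line_derivative[OF o sm azS])
      fix t assume t: "(x, a *\<^sub>R y) + t *\<^sub>R (0, w c) \<in> ?S"
      have eq: "(x, a *\<^sub>R y) + t *\<^sub>R (0, w c) = (x, a *\<^sub>R (y + (t / a) *\<^sub>R w c))"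
        using a by (simp add: scaleR_add_right)
      have "(x, y + (t / a) *\<^sub>R w c) \<in> ?S" using t unfolding eq sc_image[OF c] using a by auto
      from hom[OF a this] show "?\<phi> t = energy L c ((x, a *\<^sub>R y) + t *\<^sub>R (0, w c))" unfolding eq by simp
    qed
    moreover have "((\<lambda>t. energy L c (x, y + (t / a) *\<^sub>R w c)) has_real_derivative
        frechet_derivative (energy L c) (at (x, y)) ((1 / a) *\<^sub>R (0, w c))) (at 0)"
      by (rule line_derivative[OF o sm zS]) simp
    then have "(?\<phi> has_real_derivative a\<^sup>2 * frechet_derivative (energy L c) (at (x, y)) ((1 / a) *\<^sub>R (0, w c))) (at 0)"
      by (rule DERIV_cmult)
    ultimately have "?d (x, a *\<^sub>R y) = a\<^sup>2 * frechet_derivative (energy L c) (at (x, y)) ((1 / a) *\<^sub>R (0, w c))"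
      by (rule DERIV_unique)
    then show ?thesis
      unfolding linear_scale[OF smooth_on_linear_derivative[OF sm zS]] using a by (simp add: power2_eq_square)
  qed
  have "((\<lambda>t. ?d (x, (1 + t) *\<^sub>R y)) has_real_derivative frechet_derivative ?d (at (x, y)) (0, y)) (at 0)"
    by (rule line_derivative[OF o smooth_on_partial[OF sm] zS]) (simp add: scaleR_add_left)
  then have "((\<lambda>t. (1 + t) * ?d (x, y)) has_real_derivative frechet_derivative ?d (at (x, y)) (0, y)) (at 0)"
    by (rule has_field_derivative_transform_within_open[of _ _ _ "{-1<..}"]) (use d in auto)
  moreover have "((\<lambda>t. (1 + t) * ?d (x, y)) has_real_derivative ?d (x, y)) (at 0)"
    by (auto intro!: derivative_eq_intros)
  ultimately have "frechet_derivative ?d (at (x, y)) (0, y) = ?d (x, y)"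
    by (rule DERIV_unique)
  then show ?thesis
    unfolding fund_tensor_energy[OF L c u ut w, folded eta_def] z using y by (simp add: eta_def)
qed

end

section \<open>The Cartan connection\<close>

locale cartan = regular_connection M D
  for M :: "('a, real ^ 'n) chart set" and D +
  fixes L :: "('a, real ^ 'n) tpoint \<Rightarrow> real"
  assumes finsler: "finsler_structure M L" and cartan: "is_cartan_connection M L D"
begin

abbreviation "SB \<equiv> slit_bundle M"
lemmas oSB = openin_slit_bundle

lemma beta_field_smooth:
  "Y \<in> pi_vector_fields M \<Longrightarrow> beta_field M D Y \<in> vector_fields (slit_atlas M) SB"
  by (rule beta_vector_field[OF regular_connection_axioms oSB])

lemmas gamma_field_smooth = gamma_vector_field[OF oSB]

lemma gamma_beta_bracket:
  "X \<in> pi_vector_fields M \<Longrightarrow> Y \<in> pi_vector_fields M \<Longrightarrow>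
    lie_bracket (slit_atlas M) (gamma_field M X) (beta_field M D Y) \<in> vector_fields (slit_atlas M) SB"
  by (intro slit.lie_bracket_vector_field[OF oSB] gamma_field_smooth beta_field_smooth)

lemma rho_beta: "Y \<in> pi_vector_fields M \<Longrightarrow> u \<in> SB \<Longrightarrow> rho M u (beta_field M D Y u) = Y u"
  unfolding beta_field_def by (intro hlift(2) pi_sections_tangent)

lemma K_beta: "Y \<in> pi_vector_fields M \<Longrightarrow> u \<in> SB \<Longrightarrow> K u (beta_field M D Y u) = 0"
  unfolding beta_field_def by (intro hlift(3) pi_sections_tangent)

lemma rho_gamma: "X \<in> pi_vector_fields M \<Longrightarrow> u \<in> SB \<Longrightarrow> rho M u (gamma_field M X u) = 0"
  unfolding gamma_field_def by (intro rho_vlift pi_sections_tangent)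

text \<open>In a chart \<open>\<gamma>X = (0, X)\<close> and \<open>\<beta>Z\<close> has base component \<open>Z\<close>, so the base component of their
  bracket is the derivative of \<open>Z\<close> along the fibre direction \<open>X\<close>. The smoothness of \<open>\<beta>Z\<close> is
  needed to differentiate its components one at a time.\<close>

lemma rho_gamma_beta_bracket:
  assumes X: "X \<in> pi_vector_fields M" and Z: "Z \<in> pi_vector_fields M" and c: "c \<in> M" and u: "u \<in> fst (sc c)"
  shows "rho M u (lie_bracket (slit_atlas M) (gamma_field M X) (beta_field M D Z) u) c
    = frechet_derivative (\<lambda>z. Z (chart_inv (sc c) z) c) (at (snd (sc c) u)) (0, X u c)"
proof -
  let ?z = "snd (sc c) u" and ?S = "snd (sc c) ` fst (sc c)"
  let ?g = "\<lambda>z. gamma_field M X (chart_inv (sc c) z) (sc c)" and ?b = "\<lambda>z. beta_field M D Z (chart_inv (sc c) z) (sc c)"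
  have us: "u \<in> SB" using u by (simp add: fst_sc)
  have S: "open ?S" "?z \<in> ?S" "SB \<inter> fst (sc c) = fst (sc c)" using open_sc[OF c] u by (auto simp: fst_sc)
  have d: "((\<lambda>z. W (chart_inv (sc c) z) (sc c)) has_derivative
       frechet_derivative (\<lambda>z. W (chart_inv (sc c) z) (sc c)) (at ?z)) (at ?z)"
    if "W \<in> vector_fields (slit_atlas M) SB" for W
    using that c S unfolding slit_vector_fields_iff[OF oSB] by (intro smooth_on_has_derivative[OF _ S(2)]) auto
  have wS: "chart_inv (sc c) z \<in> fst (sc c)" "chart_inv (sc c) z \<in> SB" if "z \<in> ?S" for z
    using that c by (auto simp: sc_inv fst_sc)
  have fstb: "fst (?b z) = Z (chart_inv (sc c) z) c" if "z \<in> ?S" for z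
    using rho_component[OF vector_fields_tangent[OF beta_field_smooth[OF Z] wS(2)[OF that]] c wS(1)[OF that]]
      rho_beta[OF Z wS(2)[OF that]] by simp
  have fstg: "fst (?g z) = 0" if "z \<in> ?S" for z
    using rho_component[OF vector_fields_tangent[OF gamma_field_smooth[OF X] wS(2)[OF that]] c wS(1)[OF that]]
      rho_gamma[OF X wS(2)[OF that]] by simp
  have fst_derivative: "fst (frechet_derivative f (at ?z) h) = frechet_derivative g (at ?z) h"
    if df: "(f has_derivative frechet_derivative f (at ?z)) (at ?z)" and fg: "\<And>z. z \<in> ?S \<Longrightarrow> fst (f z) = g z"
    for f :: "_ \<Rightarrow> (real ^ 'n) \<times> (real ^ 'n)" and g h
  proof -
    have "frechet_derivative (\<lambda>z. fst (f z)) (at ?z) = frechet_derivative g (at ?z)"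
      by (rule frechet_derivative_local[OF S(1,2)]) (rule fg)
    then show ?thesis using frechet_derivativeI[OF has_derivative_fst[OF df]] by metis
  qed
  have "fst (frechet_derivative ?b (at ?z) h) = frechet_derivative (\<lambda>z. Z (chart_inv (sc c) z) c) (at ?z) h" for h
    by (rule fst_derivative[OF d[OF beta_field_smooth[OF Z]] fstb])
  moreover have "fst (frechet_derivative ?g (at ?z) h) = frechet_derivative (\<lambda>z. 0) (at ?z) h" for h
    by (rule fst_derivative[OF d[OF gamma_field_smooth[OF X]] fstg])
  moreover have "gamma_field M X u (sc c) = (0, X u c)"
    using c u us by (simp add: gamma_field_def vlift_component fst_sc)
  ultimately have "fst (lie_bracket (slit_atlas M) (gamma_field M X) (beta_field M D Z) u (sc c))
     = frechet_derivative (\<lambda>z. Z (chart_inv (sc c) z) c) (at ?z) (0, X u c)"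
    using c u by (simp add: lie_bracket_def sc_in)
  then show ?thesis
    using rho_component[OF vector_fields_tangent[OF gamma_beta_bracket[OF X Z] us] c u] by simp
qed

lemma rho_gamma_beta_eta:
  assumes X: "X \<in> pi_vector_fields M" and u: "u \<in> SB"
  shows "rho M u (lie_bracket (slit_atlas M) (gamma_field M X) (beta_field M D eta) u) = X u"
proof -
  obtain c where c: "c \<in> M" "u \<in> fst (sc c)" using slit_bundle_chart u by blast
  note E = eta_pi_section[OF oSB]
  have "frechet_derivative (\<lambda>z. eta (chart_inv (sc c) z) c) (at (snd (sc c) u)) = frechet_derivative snd (at (snd (sc c) u))"
    by (rule frechet_derivative_local[OF open_sc[OF c(1)]])
      (use c in \<open>auto simp: sc_inv eta_def\<close>, simp add: snd_sc)
  also have "\<dots> = snd"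
    by (rule frechet_derivativeI[OF bounded_linear_imp_has_derivative[OF bounded_linear_snd]])
  finally have "rho M u (lie_bracket (slit_atlas M) (gamma_field M X) (beta_field M D eta) u) c = X u c"
    using rho_gamma_beta_bracket[OF X E c] by simp
  moreover have "fst u \<in> fst c" using c by (simp add: fst_sc)
  ultimately show ?thesis
    by (intro tangent_space_eqI[OF rho_tangent[OF vector_fields_tangent[OF gamma_beta_bracket[OF X E] u] u]
          pi_sections_tangent[OF X u] c(1)])
qed

text \<open>So the mixed torsion compares the vertical covariant derivative with the derivative along the
  fibre, which is a vector space.\<close>

lemma mixed_torsion_eq:
  assumes X: "X \<in> pi_vector_fields M" and Z: "Z \<in> pi_vector_fields M" and u: "u \<in> SB"
  shows "mixed_torsion M D X Z u = D u (gamma_field M X u) Z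
    - rho M u (lie_bracket (slit_atlas M) (gamma_field M X) (beta_field M D Z) u)"
proof -
  have "D u (gamma_field M X u) Z = D u (gamma_field M X u) (\<lambda>w. rho M w (beta_field M D Z w))"
    by (rule conn_local[OF oSB Z _ u vector_fields_tangent[OF gamma_field_smooth[OF X] u]]) (simp add: rho_beta[OF Z])
  moreover have "D u (beta_field M D Z u) (\<lambda>w. 0) = D u (beta_field M D Z u) (\<lambda>w. rho M w (gamma_field M X w))"
    by (rule conn_local[OF oSB zero_pi_section[OF oSB] _ u vector_fields_tangent[OF beta_field_smooth[OF Z] u]])
      (simp add: rho_gamma[OF X])
  ultimately show ?thesis
    using conn_zero[OF u vector_fields_tangent[OF beta_field_smooth[OF Z] u]]
    by (simp add: mixed_torsion_def torsion_form_def)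
qed

text \<open>By Euler's relation \<open>g(\<eta>, Z)\<close> is the fibre derivative of the energy in the direction \<open>Z\<close>.
  Differentiating it once more along the fibre gives \<open>g(X, Z)\<close>, plus a term from the variation
  of \<open>Z\<close>. No derivative of \<open>g\<close> appears.\<close>

lemma metric_derivative_eta:
  assumes X: "X \<in> pi_vector_fields M" and Z: "Z \<in> pi_vector_fields M" and u: "u \<in> SB"
  shows "dir_deriv (slit_atlas M) u (gamma_field M X u) (\<lambda>w. fund_tensor L w (eta w) (Z w))
    = fund_tensor L u (X u) (Z u) + fund_tensor L u (eta u)
        (rho M u (lie_bracket (slit_atlas M) (gamma_field M X) (beta_field M D Z) u))"
proof -
  obtain c where c: "c \<in> M" "u \<in> fst (sc c)" "chart_at (slit_atlas M) u = sc c"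
    using slit_chart_at u by blast
  let ?z = "snd (sc c) u" and ?S = "snd (sc c) ` fst (sc c)" and ?Z = "\<lambda>z. Z (chart_inv (sc c) z) c"
  let ?R = "rho M u (lie_bracket (slit_atlas M) (gamma_field M X) (beta_field M D Z) u)"
  note sm = energy_smooth[OF finsler c(1)]
  have S: "open ?S" "?z \<in> ?S" "SB \<inter> fst (sc c) = fst (sc c)" using open_sc[OF c(1)] c by (auto simp: fst_sc)
  have Zd: "(?Z has_derivative frechet_derivative ?Z (at ?z)) (at ?z)"
    using Z c S unfolding pi_sections_iff[OF oSB] by (intro smooth_on_has_derivative[OF _ S(2)]) auto
  have "((\<lambda>z. frechet_derivative (energy L c) (at z) (0, ?Z z)) has_derivative
      (\<lambda>h. frechet_derivative (\<lambda>y. frechet_derivative (energy L c) (at y) (0, ?Z ?z)) (at ?z) h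
       + frechet_derivative (energy L c) (at ?z) (0, frechet_derivative ?Z (at ?z) h))) (at ?z)"
    by (rule has_derivative_derivative_along[OF S(1) sm S(2)]) (intro has_derivative_Pair Zd has_derivative_const)
  moreover have "frechet_derivative (energy L c) (at z) (0, ?Z z)
      = ((\<lambda>w. fund_tensor L w (eta w) (Z w)) \<circ> chart_inv (sc c)) z" if "z \<in> ?S" for z
  proof -
    obtain w where w: "w \<in> fst (sc c)" "z = snd (sc c) w" using \<open>z \<in> ?S\<close> by auto
    have "Z w \<in> tangent_space M (fst w)" using w by (intro pi_sections_tangent[OF Z]) (simp add: fst_sc)
    then show ?thesis using fund_tensor_eta[OF finsler c(1) w(1)] w c by (simp add: sc_inv)
  qed
  ultimately have "(((\<lambda>w. fund_tensor L w (eta w) (Z w)) \<circ> chart_inv (sc c)) has_derivative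
      (\<lambda>h. frechet_derivative (\<lambda>y. frechet_derivative (energy L c) (at y) (0, ?Z ?z)) (at ?z) h
       + frechet_derivative (energy L c) (at ?z) (0, frechet_derivative ?Z (at ?z) h))) (at ?z)"
    by (rule has_derivative_transform_within_open[OF _ S(1,2)])
  from frechet_derivativeI[OF this]
  have "dir_deriv (slit_atlas M) u (gamma_field M X u) (\<lambda>w. fund_tensor L w (eta w) (Z w))
    = frechet_derivative (\<lambda>y. frechet_derivative (energy L c) (at y) (0, Z u c)) (at ?z) (0, X u c)
       + frechet_derivative (energy L c) (at ?z) (0, ?R c)"
    using rho_gamma_beta_bracket[OF X Z c(1,2)] c u
    by (simp add: dir_deriv_def Let_def sc_inv gamma_field_def vlift_component fst_sc)
  then show ?thesis
    using fund_tensor_energy[OF finsler c(1,2) pi_sections_tangent[OF X u] pi_sections_tangent[OF Z u]]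
      fund_tensor_eta[OF finsler c(1,2) rho_tangent[OF vector_fields_tangent[OF gamma_beta_bracket[OF X Z] u] u]]
    by simp
qed

text \<open>Put \<open>Z = K\<gamma>X - X\<close>, which is the mixed torsion \<open>T(X, \<eta>)\<close>. Comparing the two expressions for
  the derivative of \<open>g(\<eta>, Z)\<close> along \<open>\<gamma>X\<close>, one from the metric condition and one from Euler's
  relation, gives \<open>g(T(X, \<eta>), Z) + g(\<eta>, T(X, Z)) = 0\<close>. By the symmetry of \<open>T\<close> the two summands
  agree, so \<open>g(Z, Z) = 0\<close>.\<close>

lemma K_gamma:
  assumes X: "X \<in> pi_vector_fields M" and u: "u \<in> SB"
  shows "K u (gamma_field M X u) = X u"
proof -
  note E = eta_pi_section[OF oSB]
  define Z where "Z = (\<lambda>u. K u (gamma_field M X u) - X u)"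
  have Z: "Z \<in> pi_vector_fields M"
    unfolding Z_def by (intro diff_pi_section[OF oSB] K_section gamma_field_smooth X)
  let ?g = "fund_tensor L u"
  let ?R = "rho M u (lie_bracket (slit_atlas M) (gamma_field M X) (beta_field M D Z) u)"
  let ?D = "D u (gamma_field M X u) Z"
  note gT = vector_fields_tangent[OF gamma_field_smooth[OF X] u]
  have T: "X u \<in> tangent_space M (fst u)" "Z u \<in> tangent_space M (fst u)" "eta u \<in> tangent_space M (fst u)"
    "?R \<in> tangent_space M (fst u)" "?D \<in> tangent_space M (fst u)" "K u (gamma_field M X u) \<in> tangent_space M (fst u)"
    by (rule pi_sections_tangent[OF X u] pi_sections_tangent[OF Z u] pi_sections_tangent[OF E u]
        rho_tangent[OF vector_fields_tangent[OF gamma_beta_bracket[OF X Z] u] u]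
        conn_tangent[OF oSB Z u gT] K_tangent[OF u gT])+
  have "?g (mixed_torsion M D X eta u) (Z u) = ?g (mixed_torsion M D X Z u) (eta u)"
    using cartan[unfolded is_cartan_connection_def, THEN conjunct2, THEN conjunct2, THEN conjunct2,
        THEN conjunct2, rule_format, OF X E Z u] .
  then have "?g (Z u) (Z u) = ?g (?D - ?R) (eta u)"
    using mixed_torsion_eq[OF X E u] mixed_torsion_eq[OF X Z u] rho_gamma_beta_eta[OF X u]
    by (simp add: Z_def connection_map_def)
  also have "\<dots> = ?g (eta u) ?D - ?g (eta u) ?R"
    using T by (simp add: fund_tensor_diff_left[OF finsler u] fund_tensor_symmetric[OF finsler u _ T(3)])
  also have "\<dots> = ?g (X u) (Z u) - ?g (K u (gamma_field M X u)) (Z u)"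
  proof -
    have "is_metric_connection M L D" using cartan by (simp add: is_cartan_connection_def)
    from this[unfolded is_metric_connection_def, rule_format, OF gamma_field_smooth[OF X] E Z u]
    have "dir_deriv (slit_atlas M) u (gamma_field M X u) (\<lambda>w. fund_tensor L w (eta w) (Z w))
        = ?g (D u (gamma_field M X u) eta) (Z u) + ?g (eta u) ?D" .
    then show ?thesis
      using metric_derivative_eta[OF X Z u] by (simp add: connection_map_def)
  qed
  also have "\<dots> = - ?g (Z u) (Z u)"
    using fund_tensor_diff_left[OF finsler u T(6,1,2)] by (simp add: Z_def)
  finally have "?g (Z u) (Z u) = 0" by simp
  moreover have "0 < ?g (Z u) (Z u)" if "Z u \<noteq> 0"
    using finsler[unfolded finsler_structure_def, THEN conjunct2, THEN conjunct2, THEN conjunct2,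
        THEN bspec, OF u, THEN bspec, OF T(2), THEN mp, OF that] .
  ultimately have "Z u = 0" by linarith
  then show ?thesis by (simp add: Z_def)
qed

text \<open>The inner covariant derivatives of \<open>\<eta>\<close> are \<open>K\<gamma>X = X\<close> and \<open>K\<beta>Y = 0\<close> on the slit bundle; off it
  they are arbitrary, which does not matter because a connection is local.\<close>

lemma mixed_curvature_eta:
  assumes X: "X \<in> pi_vector_fields M" and Y: "Y \<in> pi_vector_fields M" and u: "u \<in> SB"
  shows "mixed_curvature M D X Y eta u = D u (beta_field M D Y u) X
    + K u (lie_bracket (slit_atlas M) (gamma_field M X) (beta_field M D Y) u)"
proof -
  have "D u (beta_field M D Y u) X = D u (beta_field M D Y u) (\<lambda>w. D w (gamma_field M X w) eta)"
    by (rule conn_local[OF oSB X _ u vector_fields_tangent[OF beta_field_smooth[OF Y] u]])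
      (simp add: K_gamma[OF X, unfolded connection_map_def])
  moreover have "D u (gamma_field M X u) (\<lambda>w. 0) = D u (gamma_field M X u) (\<lambda>w. D w (beta_field M D Y w) eta)"
    by (rule conn_local[OF oSB zero_pi_section[OF oSB] _ u vector_fields_tangent[OF gamma_field_smooth[OF X] u]])
      (simp add: K_beta[OF Y, unfolded connection_map_def])
  ultimately show ?thesis
    using conn_zero[OF u vector_fields_tangent[OF gamma_field_smooth[OF X] u]]
    by (simp add: mixed_curvature_def curvature_def connection_map_def)
qed

text \<open>Both sides have the same image under \<open>\<rho>\<close> and under \<open>K\<close>. The components \<open>K\<Xi>\<close> and \<open>\<rho>\<Xi>\<close> are
  again global sections, so what is known about lifts of global sections applies to them.\<close>

lemma vector_field_decomposition:
  assumes \<Xi>: "\<Xi> \<in> vector_fields (slit_atlas M) SB" and u: "u \<in> SB"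
  shows "\<Xi> u = gamma_field M (\<lambda>w. K w (\<Xi> w)) u + beta_field M D (\<lambda>w. rho M w (\<Xi> w)) u"
proof -
  let ?W = "\<lambda>w. K w (\<Xi> w)" and ?R = "\<lambda>w. rho M w (\<Xi> w)"
  have W: "?W \<in> pi_vector_fields M" by (rule K_section[OF \<Xi>])
  have R: "?R \<in> pi_vector_fields M" by (rule rho_pi_section[OF oSB \<Xi>])
  have T: "\<Xi> u \<in> ST u" "gamma_field M ?W u \<in> ST u" "beta_field M D ?R u \<in> ST u"
    using \<Xi> u gamma_field_smooth[OF W] beta_field_smooth[OF R] by (auto intro: vector_fields_tangent)
  let ?s = "1 *\<^sub>R gamma_field M ?W u + 1 *\<^sub>R beta_field M D ?R u"
  have s: "?s \<in> ST u" using T by (intro slit.combination_tangent_space)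
  have "rho M u ?s = ?R u" "K u ?s = ?W u"
    unfolding rho_linear[OF T(2,3) u] K_linear[OF u T(2,3)]
    using rho_gamma[OF W u] rho_beta[OF R u] K_gamma[OF W u] K_beta[OF R u] by auto
  then have "rho M u (1 *\<^sub>R \<Xi> u + (-1) *\<^sub>R ?s) = 0" "K u (1 *\<^sub>R \<Xi> u + (-1) *\<^sub>R ?s) = 0"
    unfolding rho_linear[OF T(1) s u] K_linear[OF u T(1) s] by auto
  then have "1 *\<^sub>R \<Xi> u + (-1) *\<^sub>R ?s = 0"
    by (intro vertical_horizontal_zero[OF u] slit.combination_tangent_space T s)
  then have "\<Xi> u - ?s = 0" by (simp only: scaleR_one scaleR_minus1_left add_uminus_conv_diff)
  then have "\<Xi> u = ?s" by (rule eq_iff_diff_eq_0[THEN iffD2])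
  then show ?thesis by simp
qed

end

theorem theorem5p3:
  fixes M :: "('a, real ^ 'n) chart set"
    and L L' :: "('a, real ^ 'n) tpoint \<Rightarrow> real"
    and D D' :: "('a, real ^ 'n) connection"
  assumes "smooth_manifold M"
    and "finsler_structure M L" and "finsler_structure M L'"
    and "is_cartan_connection M L D" and "is_cartan_connection M L' D'"
    and "\<forall>X\<in>pi_vector_fields M. \<forall>Y\<in>pi_vector_fields M. \<forall>u\<in>slit_bundle M.
           difference_tensor M D D' X Y u = 0"
  shows "is_landsberg M D \<longleftrightarrow> is_landsberg M D'"
proof -
  have atlas: "smooth_atlas M" using assms(1) by (rule smooth_manifold_atlas)
  interpret c: cartan M D L
    using atlas assms(2,4) by (auto simp: cartan_def cartan_axioms_def regular_connection_def
      regular_connection_axioms_def pullback_connection_def pullback_connection_axioms_def base_atlas_def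
      is_cartan_connection_def)
  interpret c': cartan M D' L'
    using atlas assms(3,5) by (auto simp: cartan_def cartan_axioms_def regular_connection_def
      regular_connection_axioms_def pullback_connection_def pullback_connection_axioms_def base_atlas_def
      is_cartan_connection_def)
  note oSB = c.openin_slit_bundle
  have B: "D' u (beta_field M D X u) Y = D u (beta_field M D X u) Y"
    if "X \<in> pi_vector_fields M" "Y \<in> pi_vector_fields M" "u \<in> slit_bundle M" for X Y u
    using assms(6) that by (simp add: difference_tensor_def)
  \<comment> \<open>For \<open>Y = \<eta>\<close> the hypothesis says that \<open>D\<close>-horizontal lifts are \<open>D'\<close>-horizontal.\<close>
  have beta: "beta_field M D' X u = beta_field M D X u"
    if X: "X \<in> pi_vector_fields M" and u: "u \<in> slit_bundle M" for X u
  proof -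
    have "c'.K u (beta_field M D X u) = 0"
      using B[OF X c.eta_pi_section[OF oSB] u] c.K_beta[OF X u] by (simp add: connection_map_def zero_fun_def)
    then have "hlift M D' u (rho M u (beta_field M D X u)) = beta_field M D X u"
      by (intro c'.hlift_unique[OF u] c.vector_fields_tangent[OF c.beta_field_smooth[OF X] u])
    then show ?thesis unfolding c.rho_beta[OF X u] by (simp add: beta_field_def)
  qed
  \<comment> \<open>Both connection maps kill the common horizontal spaces and are left inverse to the vertical
    lift.\<close>
  have K: "c'.K u (\<Xi> u) = c.K u (\<Xi> u)"
    if \<Xi>: "\<Xi> \<in> vector_fields (slit_atlas M) (slit_bundle M)" and u: "u \<in> slit_bundle M" for \<Xi> u
  proof -
    let ?W = "\<lambda>w. c.K w (\<Xi> w)" and ?R = "\<lambda>w. rho M w (\<Xi> w)"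
    have W: "?W \<in> pi_vector_fields M" by (rule c.K_section[OF \<Xi>])
    have R: "?R \<in> pi_vector_fields M" by (rule c.rho_pi_section[OF oSB \<Xi>])
    have "\<Xi> u = 1 *\<^sub>R gamma_field M ?W u + 1 *\<^sub>R beta_field M D' ?R u"
      using c.vector_field_decomposition[OF \<Xi> u] beta[OF R u] by simp
    then have "c'.K u (\<Xi> u) = c'.K u (1 *\<^sub>R gamma_field M ?W u + 1 *\<^sub>R beta_field M D' ?R u)"
      by simp
    also have "\<dots> = 1 *\<^sub>R c'.K u (gamma_field M ?W u) + 1 *\<^sub>R c'.K u (beta_field M D' ?R u)"
      by (rule c'.K_linear[OF u c.vector_fields_tangent[OF c.gamma_field_smooth[OF W] u] c.vector_fields_tangent[OF c'.beta_field_smooth[OF R] u]])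
    also have "\<dots> = ?W u" using c'.K_gamma[OF W u] c'.K_beta[OF R u] by simp
    finally show ?thesis .
  qed
  have "mixed_curvature M D' X Y eta u = mixed_curvature M D X Y eta u"
    if X: "X \<in> pi_vector_fields M" and Y: "Y \<in> pi_vector_fields M" and u: "u \<in> slit_bundle M" for X Y u
  proof -
    have "lie_bracket (slit_atlas M) (gamma_field M X) (beta_field M D' Y) u
        = lie_bracket (slit_atlas M) (gamma_field M X) (beta_field M D Y) u"
      by (rule c.slit.lie_bracket_cong[OF oSB u refl]) (rule beta[OF Y])
    then show ?thesis
      unfolding c.mixed_curvature_eta[OF X Y u] c'.mixed_curvature_eta[OF X Y u]
      using beta[OF Y u] B[OF Y X u] K[OF c.gamma_beta_bracket[OF X Y] u] by simp
  qed
  then show ?thesis by (auto simp: is_landsberg_def)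
qed

end
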